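(* Let $a>0$ and let $x\in[0,a]$ with $U(a-x)>0$ (automatic if $x<a$). For $q>0$ let $\mathbf e_q$ be an exponential random variable with parameter $q$, independent of $X$, and let $\tau_a^+=\inf\{t\ge0:X_t>a\}$. Then for any stopping time $T$ of $(\mathcal F_t)_{t\ge0}$ and any $A\in\mathcal F_T$, $$\mathbb P^{\downarrow}_x(A;\,T<\zeta)=\lim_{q\downarrow0}\mathbb P_x\big(A;\,T<\mathbf e_q\,\big|\,\mathbf e_q<\tau_a^+\big).$$
   Context: $\mathbb D$ is the space of càdlàg paths $\omega:[0,\infty)\to\mathbb R\cup\{\Delta\}$ with cemetery state $\Delta$: setting $\zeta=\inf\{t\ge0:\omega(t)=\Delta\}$ (the lifetime), $\omega(t)=\Delta$ for all $t\ge\zeta$. $X$ is the coordinate process and $(\mathcal F_t)_{t\ge0}$ its natural filtration. Under $\mathbb P_x$, $x\in\mathbb R$, $X$ is a non-constant, unkilled subordinator (Lévy process with non-decreasing paths) started from $x$, with $-\frac1t\log\mathbb E_0[e^{-\lambda X_t}]=\kappa\lambda+\int_0^\infty(1-e^{-\lambda y})\,\nu(dy)$, $\kappa\ge0$, $\int_{(0,\infty)}(1\wedge y)\,\nu(dy)<\infty$. Its renewal function is $U(y)=\int_0^\infty\mathbb P_0(X_t\le y)\,dt$, which is finite for all $y\in\mathbb R$ and strictly positive for $y>0$. For fixed $a>0$, the measure $\mathbb P^\downarrow_x$ on $\mathbb D$ is the law (of a sub-Markovian, i.e. killed, process) defined by the Doob $h$-transform $$\mathbb P^\downarrow_x(A;\,t<\zeta)=\mathbb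 E_x\Big[\frac{U(a-X_t)}{U(a-x)}\mathbf 1_{\{X_t\le a\}\cap A}\Big],\qquad t\ge0,\ A\in\mathcal F_t.$$ *)

theory Defs
  imports "HOL-Probability.Probability"
begin

text \<open>
  \<open>\<real> \<union> {\<Delta>}\<close> is \<^typ>\<open>real option\<close>, with \<open>\<Delta>\<close> the value \<^const>\<open>None\<close>, topologised as the disjoint
  union of the line and an isolated point.
\<close>

type_synonym path = "real \<Rightarrow> real option"

definition cemetery_topology :: "real option topology" where
  "cemetery_topology = topology (\<lambda>U. open (Some -` U))"

lemma openin_cemetery_topology [simp]:
  "openin cemetery_topology U \<longleftrightarrow> open (Some -` U)"
proof -
  have "istopology (\<lambda>U :: real option set. open (Some -` U))"
    by (auto simp: istopology_def vimage_Union open_Int open_UN)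
  then show ?thesis
    by (simp add: cemetery_topology_def)
qed

definition cemetery_borel :: "real option measure" where
  "cemetery_borel = sigma UNIV {U. openin cemetery_topology U}"

definition lifetime :: "path \<Rightarrow> ennreal" where
  "lifetime \<omega> = Inf (ennreal ` {t. 0 \<le> t \<and> \<omega> t = None})"

text \<open>Paths on \<open>[0, \<infinity>)\<close> are extensional functions on \<^typ>\<open>real\<close>.\<close>

definition cadlag_paths :: "path set" where
  "cadlag_paths = {\<omega> \<in> extensional {0..}.
     (\<forall>t\<ge>0. limitin cemetery_topology \<omega> (\<omega> t) (at_right t)) \<and>
     (\<forall>t>0. \<exists>l. limitin cemetery_topology \<omega> l (at_left t)) \<and>
     (\<forall>t\<ge>0. lifetime \<omega> \<le> ennreal t \<longrightarrow> \<omega> t = None)}"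

text \<open>
  The filtration is indexed by \<open>[0, \<infinity>]\<close>, so that stopping times may take the value \<open>\<infinity>\<close>;
  the entry at \<open>\<infinity>\<close> is the \<open>\<sigma>\<close>-algebra generated by the whole path.
\<close>

definition natural_filtration :: "ennreal \<Rightarrow> path measure" where
  "natural_filtration t = sigma cadlag_paths
     {{\<omega> \<in> cadlag_paths. \<omega> s \<in> B} | s B. 0 \<le> s \<and> ennreal s \<le> t \<and> B \<in> sets cemetery_borel}"

interpretation natural: filtration cadlag_paths natural_filtration
proof
  show "space (natural_filtration t) = cadlag_paths" for t
    unfolding natural_filtration_def by (rule space_measure_of) auto
  show "sets (natural_filtration s) \<le> sets (natural_filtration t)" if "s \<le> t" for s t
    unfolding natural_filtration_def using that
    by (subst (1 2) sets_measure_of) (auto intro!: sigma_sets_mono' intro: order_trans)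
qed

abbreviation path_space :: "path measure" where
  "path_space \<equiv> natural_filtration \<infinity>"

text \<open>
  The coordinate process as a real number. Its value at the cemetery is the unspecified
  \<^term>\<open>the None\<close>; it is only used under laws that do not charge finite lifetimes.
\<close>

definition coord :: "real \<Rightarrow> path \<Rightarrow> real" where
  "coord t \<omega> = the (\<omega> t)"

text \<open>\<open>P0\<close> is the law on path space of the subordinator started from \<open>0\<close>.\<close>

locale subordinator = prob_space P0
  for P0 :: "path measure" and \<kappa> :: real and \<nu> :: "real measure" +
  assumes sets_law: "sets P0 = sets path_space"
    and starts_at_0: "AE \<omega> in P0. \<omega> 0 = Some 0"
    and unkilled: "AE \<omega> in P0. lifetime \<omega> = \<infinity>"
    and independent_increments: "\<And>s t. 0 \<le> s \<Longrightarrow> s \<le> t \<Longrightarrow>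
      indep_set (sets (natural_filtration (ennreal s)))
        (sets (vimage_algebra (space P0) (\<lambda>\<omega>. coord t \<omega> - coord s \<omega>) borel))"
    and stationary_increments: "\<And>s t. 0 \<le> s \<Longrightarrow> s \<le> t \<Longrightarrow>
      distr P0 borel (\<lambda>\<omega>. coord t \<omega> - coord s \<omega>) = distr P0 borel (coord (t - s))"
    and nondecreasing: "AE \<omega> in P0. mono_on {0..} (\<lambda>t. coord t \<omega>)"
    and nonconstant: "\<not> (AE \<omega> in P0. \<forall>t\<ge>0. \<omega> t = \<omega> 0)"
    and drift_nonneg: "0 \<le> \<kappa>"
    and sets_levy_measure: "sets \<nu> = sets (restrict_space borel {0<..})"
    and levy_measure_integrable: "integrable \<nu> (\<lambda>y. min 1 y)"
    and laplace_exponent: "\<And>t l. 0 < t \<Longrightarrow> 0 \<le> l \<Longrightarrow>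
      - (1 / t) * ln (expectation (\<lambda>\<omega>. exp (- l * coord t \<omega>)))
        = \<kappa> * l + (\<integral>y. (1 - exp (- l * y)) \<partial>\<nu>)"

definition shift_path :: "real \<Rightarrow> path \<Rightarrow> path" where
  "shift_path x \<omega> = (\<lambda>t\<in>{0..}. map_option (\<lambda>y. x + y) (\<omega> t))"

definition started_from :: "path measure \<Rightarrow> real \<Rightarrow> path measure" where
  "started_from P0 x = distr P0 path_space (shift_path x)"

definition renewal_function :: "path measure \<Rightarrow> real \<Rightarrow> ennreal" where
  "renewal_function P0 y =
     (\<integral>\<^sup>+t\<in>{0..}. emeasure P0 {\<omega> \<in> space P0. \<exists>z\<le>y. \<omega> t = Some z} \<partial>lborel)"

definition first_passage_above :: "real \<Rightarrow> path \<Rightarrow> ennreal" where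
  "first_passage_above a \<omega> = Inf (ennreal ` {t. 0 \<le> t \<and> (\<exists>y>a. \<omega> t = Some y)})"

text \<open>
  \<open>Q\<close> is the law on path space of the Doob \<open>h\<close>-transform from \<open>x\<close> with \<open>h(y) = U(a - y)\<close>, where
  \<open>U\<close> is the renewal function. The \<open>\<forall>t A\<close> clause determines \<open>Q\<close> on the path space,
  the path killed at time \<open>0\<close> having probability \<open>0\<close> (take \<open>t = 0\<close>).
\<close>

definition is_h_transform_law :: "path measure \<Rightarrow> real \<Rightarrow> real \<Rightarrow> path measure \<Rightarrow> bool" where
  "is_h_transform_law P0 a x Q \<longleftrightarrow>
     prob_space Q \<and> sets Q = sets path_space \<and>
     (\<forall>t\<ge>0. \<forall>A\<in>sets (natural_filtration (ennreal t)).
        emeasure Q {\<omega> \<in> A. ennreal t < lifetime \<omega>} =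
        (\<integral>\<^sup>+\<omega>. renewal_function P0 (a - coord t \<omega>) / renewal_function P0 (a - x)
           * indicator ({\<omega>. \<exists>y\<le>a. \<omega> t = Some y} \<inter> A) \<omega> \<partial>started_from P0 x))"

end

theory Submission
  imports Defs
begin

text \<open>
  Write \<open>\<tau>\<close> for the first passage time above \<open>a\<close>, \<open>\<zeta>\<close> for the lifetime, and \<open>E\<^sub>x\<close> for expectation
  under the subordinator started from \<open>x\<close>. Both sides of the theorem equal

    \<open>E\<^sub>x[1\<^sub>A (\<tau> - T)\<^sup>+] / U(a - x)\<close>.

  The reason is that a monotone path is below \<open>a\<close> exactly up to time \<open>\<tau>\<close>, apart from the time \<open>\<tau>\<close>
  itself. So the time spent below \<open>a\<close> after time \<open>s\<close> is \<open>(\<tau> - s)\<^sup>+\<close>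
  (\<open>nondecreasing_occupation_time\<close>); in particular \<open>U(a - x) = E\<^sub>x[\<tau>]\<close>. This number is finite: by
  Markov's inequality \<open>P\<^sub>0(X\<^sub>t \<le> y) \<le> e\<^sup>y E\<^sub>0[exp(-X\<^sub>t)]\<close>, the right-hand side decays exponentially
  in \<open>t\<close>, and the rate of decay is positive because the subordinator is not constant
  (\<open>renewal_function_finite\<close>).

  For the conditioned side, integrate out the independent exponential time: for a measurable set \<open>B\<close>
  of pairs (path, time), \<open>P((X, e\<^sub>q) \<in> B) / q = E[\<integral> exp(-qt) 1\<^sub>B(X, t) dt]\<close>, which tends to
  \<open>E[\<integral> 1\<^sub>B(X, t) dt]\<close> as \<open>q\<close> decreases to \<open>0\<close> (\<open>exponential_clock_limit\<close>). With
  \<open>B = {A, T < t < \<tau>}\<close> and \<open>B = {t < \<tau>}\<close> the limits are \<open>E\<^sub>x[1\<^sub>A (\<tau> - T)\<^sup>+]\<close> and \<open>E\<^sub>x[\<tau>]\<close>, and the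
  conditional probability is the quotient of the two.

  For the \<open>h\<close>-transform, the Markov property at a fixed time \<open>s\<close> gives
  \<open>E\<^sub>x[1\<^sub>A U(a - X\<^sub>s)] = E\<^sub>x[1\<^sub>A (\<tau> - s)\<^sup>+]\<close> for \<open>A\<close> in the \<open>\<sigma>\<close>-algebra at time \<open>s\<close>, which is the claim for
  \<open>T = s\<close> (\<open>h_transform_fixed_time\<close>). A stopping time is approximated from above by its roundings to the grids of
  mesh \<open>1/n\<close>. On the event that the rounding takes a given grid value the fixed-time identity applies;
  after summation over the grid, the two sides converge by dominated convergence
  (\<open>stopping_time_identity\<close>). The limit on the side of the \<open>h\<close>-transform is the probability of \<open>T < \<zeta>\<close>
  because this is an open condition on \<open>T\<close> and the roundings are never below \<open>T\<close>.
\<close>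

section \<open>Measurability on path space\<close>

lemma none_vimage: "Some -` {None} = {}"
  by auto

text \<open>
  The cemetery is isolated, so a path that is right-continuous in the cemetery topology stays dead or
  stays alive immediately after \<open>t\<close>; the real-valued coordinate, although arbitrary at the
  cemetery, is therefore right-continuous everywhere.
\<close>

lemma coord_right_continuous:
  assumes "\<omega> \<in> cadlag_paths" "0 \<le> t"
  shows "((\<lambda>s. coord s \<omega>) \<longlongrightarrow> coord t \<omega>) (at_right t)"
proof (rule topological_tendstoI)
  fix V :: "real set" assume V: "open V" "coord t \<omega> \<in> V"
  let ?U = "if \<omega> t = None then {None} else Some ` V"
  have "openin cemetery_topology ?U"
    using V by (simp add: inj_vimage_image_eq none_vimage)
  moreover have "\<omega> t \<in> ?U"
    using V by (auto simp: coord_def)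
  moreover have "limitin cemetery_topology \<omega> (\<omega> t) (at_right t)"
    using assms by (simp add: cadlag_paths_def)
  ultimately have "\<forall>\<^sub>F s in at_right t. \<omega> s \<in> ?U"
    unfolding limitin_def by blast
  then show "\<forall>\<^sub>F s in at_right t. coord s \<omega> \<in> V"
    by eventually_elim (use V in \<open>auto simp: coord_def split: if_splits\<close>)
qed

lemma alive_right:
  assumes "\<omega> \<in> cadlag_paths" "0 \<le> t" "\<omega> t \<noteq> None"
  shows "\<forall>\<^sub>F s in at_right t. \<omega> s \<noteq> None"
proof -
  have "openin cemetery_topology (range Some)" by (simp add: inj_vimage_image_eq)
  moreover have "limitin cemetery_topology \<omega> (\<omega> t) (at_right t)"
    using assms by (simp add: cadlag_paths_def)
  ultimately have "\<forall>\<^sub>F s in at_right t. \<omega> s \<in> range Some"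
    using assms unfolding limitin_def by blast
  then show ?thesis by eventually_elim auto
qed

text \<open>
  The infimum in the lifetime is attained, since a path is dead from its lifetime on. Comparisons of
  the lifetime with a fixed time thus depend on a single coordinate.
\<close>

lemma lifetime_le_iff:
  assumes "\<omega> \<in> cadlag_paths" "0 \<le> t"
  shows "lifetime \<omega> \<le> ennreal t \<longleftrightarrow> \<omega> t = None"
  using assms unfolding cadlag_paths_def lifetime_def by (auto intro!: Inf_lower)

lemma space_cemetery_borel [simp]: "space cemetery_borel = UNIV"
  by (simp add: cemetery_borel_def)

lemma open_cemetery_borel: "open (Some -` U) \<Longrightarrow> U \<in> sets cemetery_borel"
  by (auto simp: cemetery_borel_def intro!: sigma_sets.Basic)

lemma the_measurable_cemetery: "the \<in> cemetery_borel \<rightarrow>\<^sub>M borel"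
  by (rule borel_measurableI) (auto intro!: open_cemetery_borel simp: vimage_def)

lemma space_natural_filtration [simp]: "space (natural_filtration t) = cadlag_paths"
  by (rule natural.space_F)

lemma sets_natural_filtration:
  "sets (natural_filtration t) = sigma_sets cadlag_paths
     {{\<omega> \<in> cadlag_paths. \<omega> s \<in> B} | s B. 0 \<le> s \<and> ennreal s \<le> t \<and> B \<in> sets cemetery_borel}"
  unfolding natural_filtration_def by (rule sets_measure_of) auto

lemma evaluation_measurable:
  assumes "0 \<le> s" "ennreal s \<le> t"
  shows "(\<lambda>\<omega>. \<omega> s) \<in> natural_filtration t \<rightarrow>\<^sub>M cemetery_borel"
proof (rule measurableI)
  fix B assume "B \<in> sets cemetery_borel"
  then have "{\<omega> \<in> cadlag_paths. \<omega> s \<in> B} \<in> sets (natural_filtration t)"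
    unfolding sets_natural_filtration using assms by (intro sigma_sets.Basic) blast
  also have "{\<omega> \<in> cadlag_paths. \<omega> s \<in> B} = (\<lambda>\<omega>. \<omega> s) -` B \<inter> space (natural_filtration t)"
    by auto
  finally show "(\<lambda>\<omega>. \<omega> s) -` B \<inter> space (natural_filtration t) \<in> sets (natural_filtration t)" .
qed simp

lemma coord_measurable_filtration:
  assumes "0 \<le> s" "ennreal s \<le> t"
  shows "coord s \<in> borel_measurable (natural_filtration t)"
  unfolding coord_def[abs_def]
  by (rule measurable_compose[OF evaluation_measurable[OF assms] the_measurable_cemetery])

lemma coord_measurable: "0 \<le> s \<Longrightarrow> coord s \<in> borel_measurable path_space"
  by (rule coord_measurable_filtration) auto

lemma sets_natural_filtration_path_space: "A \<in> sets (natural_filtration t) \<Longrightarrow> A \<in> sets path_space"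
  using natural.sets_F_mono[of t \<infinity>] by auto

lemma below_level_sets:
  assumes "0 \<le> s" "ennreal s \<le> t"
  shows "{\<omega> \<in> cadlag_paths. \<exists>y\<le>b. \<omega> s = Some y} \<in> sets (natural_filtration t)"
    and "{\<omega> \<in> cadlag_paths. \<exists>y>b. \<omega> s = Some y} \<in> sets (natural_filtration t)"
    and "{\<omega> \<in> cadlag_paths. \<omega> s = None} \<in> sets (natural_filtration t)"
proof -
  have gt: "Some ` {b<..} \<in> sets cemetery_borel"
    by (rule open_cemetery_borel) (simp add: inj_vimage_image_eq)
  have N: "{None} \<in> sets cemetery_borel"
    by (rule open_cemetery_borel) (simp add: none_vimage)
  have le: "UNIV - Some ` {b<..} - {None} \<in> sets cemetery_borel"
    using gt N sets.compl_sets[of _ cemetery_borel] by auto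
  have *: "{\<omega> \<in> cadlag_paths. \<omega> s \<in> B} \<in> sets (natural_filtration t)" if "B \<in> sets cemetery_borel" for B
    using measurable_sets[OF evaluation_measurable[OF assms] that] by (simp add: vimage_def Int_def conj_commute)
  have "{\<omega> \<in> cadlag_paths. \<exists>y\<le>b. \<omega> s = Some y} = {\<omega> \<in> cadlag_paths. \<omega> s \<in> UNIV - Some ` {b<..} - {None}}"
    by (auto simp: image_iff)
  then show "{\<omega> \<in> cadlag_paths. \<exists>y\<le>b. \<omega> s = Some y} \<in> sets (natural_filtration t)"
    using *[OF le] by simp
  have "{\<omega> \<in> cadlag_paths. \<exists>y>b. \<omega> s = Some y} = {\<omega> \<in> cadlag_paths. \<omega> s \<in> Some ` {b<..}}"
    by auto
  then show "{\<omega> \<in> cadlag_paths. \<exists>y>b. \<omega> s = Some y} \<in> sets (natural_filtration t)"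
    using *[OF gt] by simp
  show "{\<omega> \<in> cadlag_paths. \<omega> s = None} \<in> sets (natural_filtration t)"
    using *[OF N] by simp
qed

lemma eventually_at_right_rational:
  assumes "\<forall>\<^sub>F s in at_right (t::real). P s" "t < u"
  obtains r where "r \<in> \<rat>" "t < r" "r < u" "P r"
proof -
  obtain b where b: "t < b" "\<And>s. t < s \<Longrightarrow> s < b \<Longrightarrow> P s"
    using assms(1) unfolding eventually_at_right_field by blast
  obtain r where "r \<in> \<rat>" "t < r" "r < min b u"
    using Rats_dense_in_real[of t "min b u"] b assms(2) by auto
  then show ?thesis using b that by auto
qed

lemma above_level_right:
  assumes "\<omega> \<in> cadlag_paths" "0 \<le> t" "\<omega> t = Some y" "b < y"
  shows "\<forall>\<^sub>F s in at_right t. \<exists>y>b. \<omega> s = Some y"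
proof -
  have "\<forall>\<^sub>F s in at_right t. b < coord s \<omega>"
    using order_tendstoD(1)[OF coord_right_continuous[OF assms(1,2)], of b] assms by (simp add: coord_def)
  moreover have "\<forall>\<^sub>F s in at_right t. \<omega> s \<noteq> None"
    using alive_right[of \<omega> t] assms by simp
  ultimately show ?thesis
    by eventually_elim (auto simp: coord_def)
qed

text \<open>
  By right-continuity a path that exceeds the level does so on a whole interval to the right, hence at a
  rational time. This turns the uncountable infimum in the first passage time into a countable one.
\<close>

lemma first_passage_less_iff:
  assumes "\<omega> \<in> cadlag_paths"
  shows "first_passage_above b \<omega> < u \<longleftrightarrow>
    (\<exists>r\<in>\<rat>. 0 \<le> r \<and> ennreal r < u \<and> (\<exists>y>b. \<omega> r = Some y))"
proof
  assume "first_passage_above b \<omega> < u"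
  then obtain t y where t: "0 \<le> t" "ennreal t < u" "\<omega> t = Some y" "b < y"
    unfolding first_passage_above_def Inf_less_iff by auto
  obtain v where v: "ennreal t < ennreal v" "ennreal v < u"
  proof -
    obtain w where "ennreal t < w" "w < u" using dense t(2) by blast
    then show ?thesis using that[of "enn2real w"] by (cases w) auto
  qed
  then have "t < v" using t(1) by (simp add: ennreal_less_iff)
  then obtain r where "r \<in> \<rat>" "t < r" "r < v" "\<exists>y>b. \<omega> r = Some y"
    using eventually_at_right_rational[OF above_level_right[OF assms t(1,3,4)]] by blast
  moreover from this v have "ennreal r < u"
    using ennreal_less_iff[of r v] t(1) by (auto intro: less_trans)
  ultimately show "\<exists>r\<in>\<rat>. 0 \<le> r \<and> ennreal r < u \<and> (\<exists>y>b. \<omega> r = Some y)"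
    using t(1) by (intro bexI[of _ r]) auto
next
  assume "\<exists>r\<in>\<rat>. 0 \<le> r \<and> ennreal r < u \<and> (\<exists>y>b. \<omega> r = Some y)"
  then show "first_passage_above b \<omega> < u"
    unfolding first_passage_above_def Inf_less_iff by blast
qed

lemma first_passage_measurable [measurable]: "first_passage_above b \<in> borel_measurable path_space"
proof (rule borel_measurableI_less)
  fix u :: ennreal
  have "{\<omega> \<in> space path_space. first_passage_above b \<omega> < u} =
      (\<Union>r\<in>{r\<in>\<rat>. 0 \<le> r \<and> ennreal r < u}. {\<omega> \<in> cadlag_paths. \<exists>y>b. \<omega> r = Some y})"
    by (simp add: set_eq_iff first_passage_less_iff cong: conj_cong) blast
  also have "\<dots> \<in> sets path_space"
    by (intro sets.countable_UN') (auto intro!: below_level_sets countable_subset[OF _ countable_rat])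
  finally show "{\<omega> \<in> space path_space. first_passage_above b \<omega> < u} \<in> sets path_space" .
qed

lemma lifetime_measurable [measurable]: "lifetime \<in> borel_measurable path_space"
proof (rule borel_measurableI_le)
  fix u :: ennreal
  show "{\<omega> \<in> space path_space. lifetime \<omega> \<le> u} \<in> sets path_space"
  proof (cases u)
    case (real t)
    then have "{\<omega> \<in> space path_space. lifetime \<omega> \<le> u} = {\<omega> \<in> cadlag_paths. \<omega> t = None}"
      using lifetime_le_iff by auto
    then show ?thesis using real by (simp add: below_level_sets)
  next
    case top then show ?thesis using sets.top[of path_space] by simp
  qed
qed

text \<open>
  Joint measurability in time and path, which the exchanges of integrals over time and over paths need. By
  right-continuity the coordinate at \<open>t\<close> is the limit of the coordinates at the grid points
  strictly to the right of \<open>t\<close>, and these take countably many values. Negative times are read as \<open>0\<close> so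
  that the statement concerns the whole line.
\<close>

lemma coord_measurable_pair:
  "(\<lambda>(t, \<omega>). coord (max 0 t) \<omega>) \<in> borel_measurable (borel \<Otimes>\<^sub>M path_space)"
proof (rule borel_measurable_LIMSEQ_real)
  let ?d = "\<lambda>n. real (Suc n)"
  let ?g = "\<lambda>n i. (real_of_int i + 1) / ?d n"
  let ?u = "\<lambda>n (t, \<omega>). coord (max 0 (?g n \<lfloor>?d n * max 0 t\<rfloor>)) \<omega>"
  show "?u n \<in> borel_measurable (borel \<Otimes>\<^sub>M path_space)" for n
  proof -
    have "(\<lambda>z. coord (max 0 (?g n i)) (snd z)) \<in> borel_measurable (borel \<Otimes>\<^sub>M path_space)" for i
      by (rule measurable_compose[OF measurable_snd coord_measurable]) simp
    moreover have "(\<lambda>z. \<lfloor>?d n * max 0 (fst z)\<rfloor>) \<in> (borel \<Otimes>\<^sub>M path_space) \<rightarrow>\<^sub>M count_space UNIV"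
      by measurable
    ultimately have "(\<lambda>z. coord (max 0 (?g n \<lfloor>?d n * max 0 (fst z)\<rfloor>)) (snd z)) \<in> borel_measurable (borel \<Otimes>\<^sub>M path_space)"
      by (rule measurable_compose_countable)
    then show ?thesis by (simp add: split_beta')
  qed
  fix z assume "z \<in> space (borel \<Otimes>\<^sub>M path_space :: (real \<times> path) measure)"
  then obtain t \<omega> where z: "z = (t, \<omega>)" "\<omega> \<in> cadlag_paths"
    by (auto simp: space_pair_measure)
  define s where "s = max 0 t"
  have bounds: "s < ?g n \<lfloor>?d n * s\<rfloor>" "?g n \<lfloor>?d n * s\<rfloor> \<le> s + 1 / ?d n" for n
  proof -
    define d where "d = ?d n"
    have "0 < d" by (simp add: d_def)
    moreover have "d * s < real_of_int \<lfloor>d * s\<rfloor> + 1" "real_of_int \<lfloor>d * s\<rfloor> \<le> d * s"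
      by linarith+
    ultimately show "s < ?g n \<lfloor>?d n * s\<rfloor>" "?g n \<lfloor>?d n * s\<rfloor> \<le> s + 1 / ?d n"
      unfolding d_def[symmetric] by (simp_all add: field_simps)
  qed
  have "(\<lambda>n. s + 1 / ?d n) \<longlonglongrightarrow> s + 0"
    by (intro tendsto_intros LIMSEQ_Suc[OF lim_1_over_n])
  then have "(\<lambda>n. s + 1 / ?d n) \<longlonglongrightarrow> s" by simp
  with tendsto_const[of s] have "(\<lambda>n. ?g n \<lfloor>?d n * s\<rfloor>) \<longlonglongrightarrow> s"
    by (rule tendsto_sandwich[rotated 2]) (intro always_eventually allI less_imp_le bounds)+
  then have "filterlim (\<lambda>n. ?g n \<lfloor>?d n * s\<rfloor>) (at_right s) sequentially"
    by (simp only: filterlim_at greaterThan_iff)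
       (metis (mono_tags, lifting) always_eventually bounds(1) less_irrefl)
  then have "(\<lambda>n. coord (?g n \<lfloor>?d n * s\<rfloor>) \<omega>) \<longlonglongrightarrow> coord s \<omega>"
    by (rule filterlim_compose[OF coord_right_continuous[OF z(2)], rotated]) (simp add: s_def)
  moreover have "max 0 (?g n \<lfloor>?d n * s\<rfloor>) = ?g n \<lfloor>?d n * s\<rfloor>" for n
    using bounds(1)[of n] by (simp add: s_def max_def)
  ultimately show "(\<lambda>n. ?u n z) \<longlonglongrightarrow> (case z of (t, \<omega>) \<Rightarrow> coord (max 0 t) \<omega>)"
    by (simp add: z s_def[symmetric])
qed

text \<open>
  The coordinate extended to negative times, hidden behind a constant so that the automatic
  measurability rules treat it as one binary function of time and path.
\<close>

definition position :: "real \<Rightarrow> path \<Rightarrow> real" where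
  "position t \<omega> = coord (max 0 t) \<omega>"

lemma position_eq [simp]: "0 \<le> t \<Longrightarrow> position t \<omega> = coord t \<omega>"
  by (simp add: position_def)

lemma position_measurable [measurable (raw)]:
  assumes "f \<in> borel_measurable N" "g \<in> N \<rightarrow>\<^sub>M path_space"
  shows "(\<lambda>z. position (f z) (g z)) \<in> borel_measurable N"
  unfolding position_def
  using measurable_compose[OF measurable_Pair[OF assms] coord_measurable_pair] by simp

section \<open>Occupation times of monotone paths\<close>

lemma emeasure_initial_segment:
  "emeasure lborel {u. 0 \<le> u \<and> ennreal u < D} = D"
  "emeasure lborel {u. 0 \<le> u \<and> ennreal u \<le> D} = D"
proof -
  have top: "emeasure lborel {0::real..} = \<top>"
  proof (cases "emeasure lborel {0::real..}")
    case (real r)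
    have "emeasure lborel {0..r + 1} \<le> emeasure lborel {0::real..}"
      by (rule emeasure_mono) auto
    then show ?thesis using real by (simp add: real(2))
  qed
  show "emeasure lborel {u. 0 \<le> u \<and> ennreal u < D} = D"
  proof (cases D)
    case (real d)
    then have "{u. 0 \<le> u \<and> ennreal u < D} = {0..<d}" by (auto simp: ennreal_less_iff)
    then show ?thesis using real by simp
  qed (use top in \<open>simp add: atLeast_def\<close>)
  show "emeasure lborel {u. 0 \<le> u \<and> ennreal u \<le> D} = D"
  proof (cases D)
    case (real d)
    then have "{u. 0 \<le> u \<and> ennreal u \<le> D} = {0..d}" by auto
    then show ?thesis using real by simp
  qed (use top in \<open>simp add: atLeast_def\<close>)
qed

lemma nn_integral_initial_segment:
  "(\<integral>\<^sup>+u. indicator {u. 0 \<le> u \<and> ennreal u < D} u \<partial>lborel) = D"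
  "(\<integral>\<^sup>+u. indicator {u. 0 \<le> u \<and> ennreal u \<le> D} u \<partial>lborel) = D"
  by (subst nn_integral_indicator; simp add: emeasure_initial_segment)+

text \<open>
  A monotone function is at most \<open>b\<close> strictly before its first passage above \<open>b\<close> and exceeds \<open>b\<close>
  strictly after. The set of times in the integral thus lies between two intervals with the same end
  point, whatever happens at the passage time itself.
\<close>

lemma nondecreasing_occupation_time:
  fixes f :: "real \<Rightarrow> real"
  assumes mono: "mono_on {0..} f" and s: "0 \<le> s"
  shows "(\<integral>\<^sup>+u. indicator {u. 0 \<le> u \<and> f (s + u) \<le> b} u \<partial>lborel)
    = Inf (ennreal ` {t. 0 \<le> t \<and> b < f t}) - ennreal s"
    (is "?I = ?D")
proof (rule antisym)
  let ?\<sigma> = "Inf (ennreal ` {t. 0 \<le> t \<and> b < f t})"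
  have "{u. 0 \<le> u \<and> ennreal u < ?D} \<subseteq> {u. 0 \<le> u \<and> f (s + u) \<le> b}"
  proof safe
    fix u assume u: "0 \<le> u" "ennreal u < ?D"
    then have "ennreal (s + u) < ?\<sigma>"
      using s by (simp add: less_diff_eq_ennreal add.commute)
    then have "s + u \<notin> {t. 0 \<le> t \<and> b < f t}"
      by (meson Inf_lower imageI not_le)
    then show "f (s + u) \<le> b" using u s by simp
  qed
  then have "(\<integral>\<^sup>+u. indicator {u. 0 \<le> u \<and> ennreal u < ?D} u \<partial>lborel) \<le> ?I"
    by (intro nn_integral_mono) (auto simp: indicator_def)
  then show "?D \<le> ?I" by (simp add: nn_integral_initial_segment)
  have "{u. 0 \<le> u \<and> f (s + u) \<le> b} \<subseteq> {u. 0 \<le> u \<and> ennreal u \<le> ?D}"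
  proof safe
    fix u assume u: "0 \<le> u" "f (s + u) \<le> b"
    have "ennreal (s + u) \<le> ?\<sigma>"
    proof (rule Inf_greatest)
      fix z assume "z \<in> ennreal ` {t. 0 \<le> t \<and> b < f t}"
      then obtain t where t: "z = ennreal t" "0 \<le> t" "b < f t" by auto
      have "\<not> t \<le> s + u"
        using mono_onD[OF mono, of t "s + u"] t u s by auto
      then show "ennreal (s + u) \<le> z" using t by (simp add: ennreal_leI)
    qed
    then show "ennreal u \<le> ?D"
      using s u by (simp add: ennreal_le_minus_iff add.commute)
  qed
  then have "?I \<le> (\<integral>\<^sup>+u. indicator {u. 0 \<le> u \<and> ennreal u \<le> ?D} u \<partial>lborel)"
    by (intro nn_integral_mono) (auto simp: indicator_def)
  then show "?I \<le> ?D" by (simp add: nn_integral_initial_segment)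
qed

text \<open>
  For \<open>D = S = \<infinity>\<close> the difference in the extended reals is \<open>\<infinity>\<close> while the segment is empty.
  This is why \<open>D\<close> has to be finite here and why the finiteness of the renewal function matters below.
\<close>

lemma nn_integral_open_segment:
  assumes "D \<noteq> \<top>"
  shows "(\<integral>\<^sup>+t. indicator {0..} t * indicator {t. S < ennreal t \<and> ennreal t < D} t \<partial>lborel) = D - S"
proof (cases "S < D")
  case True
  then obtain s d where sd: "S = ennreal s" "D = ennreal d" "0 \<le> s" "0 \<le> d" "s \<le> d"
    using assms by (cases S; cases D) (auto simp: ennreal_less_iff)
  have "(\<integral>\<^sup>+t. indicator {0..} t * indicator {t. S < ennreal t \<and> ennreal t < D} t \<partial>lborel)
      = (\<integral>\<^sup>+t. indicator {s<..<d} t \<partial>lborel)"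
    using sd by (intro nn_integral_cong) (auto simp: indicator_def ennreal_less_iff)
  also have "\<dots> = D - S"
    using sd by (simp add: ennreal_minus)
  finally show ?thesis .
next
  case False
  then have "indicator {t. S < ennreal t \<and> ennreal t < D} t = (0::ennreal)" for t
    by (auto simp: indicator_def dest: less_trans)
  then show ?thesis using False assms by (simp add: diff_eq_0_iff_ennreal less_top not_less)
qed

section \<open>Joint law of independent random variables\<close>

text \<open>
  Independence as product of laws for random variables whose value types differ, such as a path and a
  real number.
\<close>

lemma (in prob_space) indep_set_joint_law:
  assumes X [measurable]: "random_variable N X" and Y [measurable]: "random_variable L Y"
    and indep: "indep_set (sets (vimage_algebra (space M) X N)) (sets (vimage_algebra (space M) Y L))"
  shows "distr M (N \<Otimes>\<^sub>M L) (\<lambda>\<omega>. (X \<omega>, Y \<omega>)) = distr M N X \<Otimes>\<^sub>M distr M L Y"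
proof (rule pair_measure_eqI[symmetric])
  interpret X: prob_space "distr M N X" by (rule prob_space_distr) fact
  interpret Y: prob_space "distr M L Y" by (rule prob_space_distr) fact
  show "sigma_finite_measure (distr M N X)" "sigma_finite_measure (distr M L Y)"
    by unfold_locales
  show "sets (distr M N X \<Otimes>\<^sub>M distr M L Y) = sets (distr M (N \<Otimes>\<^sub>M L) (\<lambda>\<omega>. (X \<omega>, Y \<omega>)))"
    by (simp cong: sets_pair_measure_cong)
  fix A B assume "A \<in> sets (distr M N X)" "B \<in> sets (distr M L Y)"
  then have [measurable]: "A \<in> sets N" "B \<in> sets L" by auto
  have "prob ((X -` A \<inter> space M) \<inter> (Y -` B \<inter> space M)) = prob (X -` A \<inter> space M) * prob (Y -` B \<inter> space M)"
    by (rule indep_setD[OF indep]; rule in_vimage_algebra) measurable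
  moreover have "(\<lambda>\<omega>. (X \<omega>, Y \<omega>)) -` (A \<times> B) \<inter> space M = (X -` A \<inter> space M) \<inter> (Y -` B \<inter> space M)"
    by auto
  ultimately show "emeasure (distr M N X) A * emeasure (distr M L Y) B
      = emeasure (distr M (N \<Otimes>\<^sub>M L) (\<lambda>\<omega>. (X \<omega>, Y \<omega>))) (A \<times> B)"
    by (simp add: emeasure_distr emeasure_eq_measure ennreal_mult)
qed

section \<open>The renewal function of a subordinator\<close>

context subordinator
begin

declare sets_law [measurable_cong]

lemma space_law: "space P0 = cadlag_paths"
  using sets_eq_imp_space_eq[OF sets_law] by simp

text \<open>
  All almost sure properties of the sample paths in the form in which they are used: the path is alive
  forever, starts from \<open>0\<close> and is non-decreasing.
\<close>

lemma AE_regular: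
  "AE \<omega> in P0. \<omega> \<in> cadlag_paths \<and> (\<forall>t\<ge>0. \<omega> t = Some (coord t \<omega>))
     \<and> coord 0 \<omega> = 0 \<and> mono_on {0..} (\<lambda>t. coord t \<omega>)"
  using starts_at_0 unkilled nondecreasing AE_space
proof eventually_elim
  case (elim \<omega>)
  then have "\<omega> \<in> cadlag_paths" by (simp add: space_law)
  moreover have "\<omega> t = Some (coord t \<omega>)" if "0 \<le> t" for t
    using lifetime_le_iff[OF \<open>\<omega> \<in> cadlag_paths\<close> that] elim by (auto simp: coord_def top_unique)
  ultimately show ?case using elim by (simp add: coord_def)
qed

lemma AE_nonneg: "AE \<omega> in P0. \<forall>t\<ge>0. 0 \<le> coord t \<omega>"
  using AE_regular
proof eventually_elim
  case (elim \<omega>)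
  show ?case
  proof safe
    fix t :: real assume "0 \<le> t"
    with elim show "0 \<le> coord t \<omega>"
      using mono_onD[of "{0..}" "\<lambda>t. coord t \<omega>" 0 t] by auto
  qed
qed

lemma coord_random_variable: "0 \<le> t \<Longrightarrow> random_variable borel (coord t)"
  using coord_measurable by measurable

text \<open>
  The residual passage time \<open>\<tau> - s\<close> is the time spent below the level after time \<open>s\<close>. The exceptional
  set is chosen independently of the level and of \<open>s\<close>.
\<close>

lemma first_passage_occupation:
  "AE \<omega> in P0. \<forall>b s. 0 \<le> s \<longrightarrow>
     (\<integral>\<^sup>+u. indicator {0..} u * indicator {\<omega>. coord (s + u) \<omega> \<le> b} \<omega> \<partial>lborel)
       = first_passage_above b \<omega> - ennreal s"
  using AE_regular
proof eventually_elim
  case (elim \<omega>)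
  show ?case
  proof (intro allI impI)
    fix b s :: real assume s: "0 \<le> s"
    have "(\<integral>\<^sup>+u. indicator {0..} u * indicator {\<omega>. coord (s + u) \<omega> \<le> b} \<omega> \<partial>lborel)
        = (\<integral>\<^sup>+u. indicator {u. 0 \<le> u \<and> coord (s + u) \<omega> \<le> b} u \<partial>lborel)"
      by (intro nn_integral_cong) (auto simp: indicator_def)
    also have "\<dots> = Inf (ennreal ` {t. 0 \<le> t \<and> b < coord t \<omega>}) - ennreal s"
      by (rule nondecreasing_occupation_time) (use elim s in auto)
    also have "{t. 0 \<le> t \<and> b < coord t \<omega>} = {t. 0 \<le> t \<and> (\<exists>y>b. \<omega> t = Some y)}"
      using elim by auto
    finally show "(\<integral>\<^sup>+u. indicator {0..} u * indicator {\<omega>. coord (s + u) \<omega> \<le> b} \<omega> \<partial>lborel)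
        = first_passage_above b \<omega> - ennreal s"
      unfolding first_passage_above_def .
  qed
qed

lemma renewal_function_alt:
  "renewal_function P0 y =
    (\<integral>\<^sup>+u. indicator {0..} u * (\<integral>\<^sup>+\<omega>. indicator {\<omega>. coord u \<omega> \<le> y} \<omega> \<partial>P0) \<partial>lborel)"
  unfolding renewal_function_def
proof (intro nn_integral_cong)
  fix t :: real
  have "emeasure P0 {\<omega> \<in> space P0. \<exists>z\<le>y. \<omega> t = Some z} = (\<integral>\<^sup>+\<omega>. indicator {\<omega>. coord t \<omega> \<le> y} \<omega> \<partial>P0)"
    if t: "0 \<le> t"
  proof -
    note [measurable] = coord_random_variable[OF t]
    have "emeasure P0 {\<omega> \<in> space P0. \<exists>z\<le>y. \<omega> t = Some z} = emeasure P0 {\<omega> \<in> space P0. coord t \<omega> \<le> y}"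
    proof (rule emeasure_eq_AE)
      show "AE \<omega> in P0. (\<omega> \<in> {\<omega> \<in> space P0. \<exists>z\<le>y. \<omega> t = Some z}) = (\<omega> \<in> {\<omega> \<in> space P0. coord t \<omega> \<le> y})"
        using AE_regular by eventually_elim (use t in auto)
      show "{\<omega> \<in> space P0. \<exists>z\<le>y. \<omega> t = Some z} \<in> sets P0"
        using below_level_sets(1)[OF t, of \<infinity> y] by (simp add: sets_law space_law)
    qed measurable
    also have "\<dots> = (\<integral>\<^sup>+\<omega>. indicator {\<omega> \<in> space P0. coord t \<omega> \<le> y} \<omega> \<partial>P0)"
      by (subst nn_integral_indicator) auto
    also have "\<dots> = (\<integral>\<^sup>+\<omega>. indicator {\<omega>. coord t \<omega> \<le> y} \<omega> \<partial>P0)"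
      by (intro nn_integral_cong) (auto simp: indicator_def)
    finally show ?thesis .
  qed
  then show "emeasure P0 {\<omega> \<in> space P0. \<exists>z\<le>y. \<omega> t = Some z} * indicator {0..} t =
      indicator {0..} t * (\<integral>\<^sup>+\<omega>. indicator {\<omega>. coord t \<omega> \<le> y} \<omega> \<partial>P0)"
    by (auto simp: indicator_def)
qed

lemma exp_integrable: "0 \<le> t \<Longrightarrow> integrable P0 (\<lambda>\<omega>. exp (- coord t \<omega>))"
proof (rule integrable_const_bound[of _ 1])
  assume t: "0 \<le> t"
  show "AE \<omega> in P0. norm (exp (- coord t \<omega>)) \<le> 1"
    using AE_nonneg by eventually_elim (use t in auto)
  show "(\<lambda>\<omega>. exp (- coord t \<omega>)) \<in> borel_measurable P0"
    using coord_random_variable[OF t] by measurable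
qed

text \<open>
  The Laplace exponent at \<open>1\<close>, which is the exponential rate at which \<open>E\<^sub>0[exp(-X\<^sub>t)]\<close> decays.
\<close>

definition rate :: real where
  "rate = \<kappa> * 1 + (\<integral>y. (1 - exp (- 1 * y)) \<partial>\<nu>)"

lemma laplace_transform_at_one:
  assumes t: "0 \<le> t"
  shows "expectation (\<lambda>\<omega>. exp (- coord t \<omega>)) = exp (- t * rate)"
proof (cases "t = 0")
  case True
  have "expectation (\<lambda>\<omega>. exp (- coord t \<omega>)) = expectation (\<lambda>_. 1)"
  proof (rule integral_cong_AE)
    show "(\<lambda>\<omega>. exp (- coord t \<omega>)) \<in> borel_measurable P0"
      using coord_random_variable[OF t] by measurable
    show "AE \<omega> in P0. exp (- coord t \<omega>) = 1"
      using AE_regular by eventually_elim (use True in auto)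
  qed simp
  then show ?thesis using True by (simp add: prob_space)
next
  case False
  have "0 < expectation (\<lambda>\<omega>. exp (- coord t \<omega>))"
    by (rule expectation_greater) (auto simp: exp_integrable t)
  moreover have "ln (expectation (\<lambda>\<omega>. exp (- coord t \<omega>))) = - t * rate"
    using laplace_exponent[of t 1] t False by (simp add: rate_def field_simps)
  ultimately show ?thesis by (metis exp_ln)
qed

text \<open>
  If the rate were not positive, \<open>exp(-X\<^sub>n)\<close>, which is at most \<open>1\<close>, would have expectation at least
  \<open>1\<close>. Then \<open>X\<^sub>n = 0\<close> almost surely for all integers \<open>n\<close>, so by monotonicity the path would be constant.
\<close>

lemma rate_pos: "0 < rate"
proof (rule ccontr)
  assume "\<not> 0 < rate"
  have "AE \<omega> in P0. coord (real n) \<omega> = 0" for n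
  proof -
    have int: "integrable P0 (\<lambda>\<omega>. 1 - exp (- coord (real n) \<omega>))"
      using exp_integrable[of "real n"] by simp
    have nonneg: "AE \<omega> in P0. 0 \<le> 1 - exp (- coord (real n) \<omega>)"
      using AE_nonneg by eventually_elim auto
    have "expectation (\<lambda>\<omega>. 1 - exp (- coord (real n) \<omega>)) = 1 - exp (- real n * rate)"
      using exp_integrable[of "real n"] by (simp add: laplace_transform_at_one prob_space)
    also have "\<dots> \<le> 0"
      using \<open>\<not> 0 < rate\<close> by (simp add: mult_nonneg_nonpos)
    finally have "expectation (\<lambda>\<omega>. 1 - exp (- coord (real n) \<omega>)) = 0"
      using integral_nonneg_AE[OF nonneg] by simp
    then have "AE \<omega> in P0. 1 - exp (- coord (real n) \<omega>) = 0"
      using integral_nonneg_eq_0_iff_AE[OF int nonneg] by simp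
    then show ?thesis by eventually_elim simp
  qed
  then have "AE \<omega> in P0. \<forall>n. coord (real n) \<omega> = 0"
    by (simp add: AE_all_countable)
  with AE_regular AE_nonneg have "AE \<omega> in P0. \<forall>t\<ge>0. \<omega> t = \<omega> 0"
  proof eventually_elim
    case (elim \<omega>)
    show ?case
    proof (intro allI impI)
      fix t :: real assume t: "0 \<le> t"
      obtain n where n: "t \<le> real n" using real_arch_simple by blast
      have "coord t \<omega> \<le> coord (real n) \<omega>"
        using mono_onD[of "{0..}" "\<lambda>t. coord t \<omega>" t "real n"] elim t n by auto
      then have "coord t \<omega> = 0" using elim t by (auto intro: antisym)
      then show "\<omega> t = \<omega> 0" using elim t by auto
    qed
  qed
  then show False using nonconstant by simp
qed

text \<open>
  Markov's inequality for \<open>exp(-X\<^sub>u)\<close> bounds the integrand by \<open>exp(y) exp(-u \<Phi>)\<close>, where \<open>\<Phi>\<close> is the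
  rate. Up to a constant this is the density of the exponential distribution with parameter \<open>\<Phi>\<close>.
\<close>

lemma renewal_function_finite: "renewal_function P0 y < \<infinity>"
proof -
  have "renewal_function P0 y \<le> (\<integral>\<^sup>+u. ennreal (exp y / rate) * ennreal (exponential_density rate u) \<partial>lborel)"
    unfolding renewal_function_alt
  proof (rule nn_integral_mono)
    fix u :: real
    have "(\<integral>\<^sup>+\<omega>. indicator {\<omega>. coord u \<omega> \<le> y} \<omega> \<partial>P0) \<le> ennreal (exp y * exp (- u * rate))" if u: "0 \<le> u"
    proof -
      have "(\<integral>\<^sup>+\<omega>. indicator {\<omega>. coord u \<omega> \<le> y} \<omega> \<partial>P0) \<le> (\<integral>\<^sup>+\<omega>. ennreal (exp y * exp (- coord u \<omega>)) \<partial>P0)"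
      proof (rule nn_integral_mono)
        fix \<omega>
        show "indicator {\<omega>. coord u \<omega> \<le> y} \<omega> \<le> ennreal (exp y * exp (- coord u \<omega>))"
          by (auto simp: indicator_def simp flip: exp_add)
      qed
      also have "\<dots> = ennreal (expectation (\<lambda>\<omega>. exp y * exp (- coord u \<omega>)))"
        by (rule nn_integral_eq_integral) (auto simp: exp_integrable u)
      also have "\<dots> = ennreal (exp y * exp (- u * rate))"
        by (simp add: laplace_transform_at_one u)
      finally show ?thesis .
    qed
    then show "indicator {0..} u * (\<integral>\<^sup>+\<omega>. indicator {\<omega>. coord u \<omega> \<le> y} \<omega> \<partial>P0)
        \<le> ennreal (exp y / rate) * ennreal (exponential_density rate u)"
      using rate_pos by (auto simp: indicator_def exponential_density_def simp flip: ennreal_mult)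
  qed
  also have "\<dots> = ennreal (exp y / rate) * (\<integral>\<^sup>+u. ennreal (exponential_density rate u) \<partial>lborel)"
    by (rule nn_integral_cmult) simp
  also have "(\<integral>\<^sup>+u. ennreal (exponential_density rate u) \<partial>lborel) = 1"
    using prob_space.emeasure_space_1[OF prob_space_exponential_density[OF rate_pos]]
    by (simp add: emeasure_density)
  finally show ?thesis
    by (simp add: le_less_trans)
qed

text \<open>
  This makes the indicator of \<open>X\<^sub>t \<le> a\<close> in the \<open>h\<close>-transform automatic.
\<close>

lemma renewal_function_negative:
  assumes "y < 0"
  shows "renewal_function P0 y = 0"
proof -
  have "(\<integral>\<^sup>+\<omega>. indicator {\<omega>. coord u \<omega> \<le> y} \<omega> \<partial>P0) = (\<integral>\<^sup>+\<omega>. 0 \<partial>P0)" if "0 \<le> u" for u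
    using AE_nonneg by (intro nn_integral_cong_AE, eventually_elim) (use that assms in \<open>force simp: indicator_def\<close>)
  then have eq: "indicator {0..} u * (\<integral>\<^sup>+\<omega>. indicator {\<omega>. coord u \<omega> \<le> y} \<omega> \<partial>P0) = (0::ennreal)" for u
    by (auto simp: indicator_def)
  show ?thesis unfolding renewal_function_alt eq by simp
qed

lemma renewal_function_measurable [measurable]: "renewal_function P0 \<in> borel_measurable borel"
proof -
  have "renewal_function P0 = (\<lambda>y. \<integral>\<^sup>+u. indicator {0..} u * (\<integral>\<^sup>+\<omega>. indicator {0..} (y - position u \<omega>) \<partial>P0) \<partial>lborel)"
    unfolding renewal_function_alt[abs_def]
    by (intro ext nn_integral_cong) (auto simp: indicator_def intro!: nn_integral_cong)
  also have "\<dots> \<in> borel_measurable borel" by measurable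
  finally show ?thesis .
qed

section \<open>The Markov property at a fixed time\<close>

text \<open>
  The simple Markov property for events \<open>{X\<^bsub>s+u\<^esub> \<le> c}\<close>: the path up to time \<open>s\<close> and the increment over
  \<open>[s, s+u]\<close> have a product law, and the increment has the law of \<open>X\<^sub>u\<close>.
\<close>

lemma markov_at_fixed_time:
  assumes s: "0 \<le> s" and u: "0 \<le> u" and B: "B \<in> sets (natural_filtration (ennreal s))"
  shows "(\<integral>\<^sup>+\<omega>. indicator B \<omega> * indicator {\<omega>. coord (s + u) \<omega> \<le> c} \<omega> \<partial>P0)
    = (\<integral>\<^sup>+\<omega>. indicator B \<omega> * (\<integral>\<^sup>+\<omega>'. indicator {\<omega>'. coord u \<omega>' \<le> c - coord s \<omega>} \<omega>' \<partial>P0) \<partial>P0)"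
proof -
  let ?F = "natural_filtration (ennreal s)"
  let ?Y = "\<lambda>\<omega>. coord (s + u) \<omega> - coord s \<omega>"
  note [measurable] = B coord_random_variable[OF s] coord_random_variable[OF u]
    coord_measurable_filtration[OF s order_refl]
  have Y[measurable]: "random_variable borel ?Y"
    by (rule borel_measurable_diff; rule coord_random_variable) (use s u in auto)
  have id_F: "(\<lambda>\<omega>. \<omega>) \<in> P0 \<rightarrow>\<^sub>M ?F"
  proof (rule measurableI)
    fix A assume A: "A \<in> sets ?F"
    then have "(\<lambda>\<omega>. \<omega>) -` A \<inter> space P0 = A"
      using sets.sets_into_space[of A ?F] by (auto simp: space_law)
    then show "(\<lambda>\<omega>. \<omega>) -` A \<inter> space P0 \<in> sets P0"
      using sets_natural_filtration_path_space[OF A] by (simp add: sets_law)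
  qed (simp add: space_law)
  have "sets (vimage_algebra (space P0) (\<lambda>\<omega>. \<omega>) ?F) = sets ?F"
  proof -
    have "{(\<lambda>\<omega>. \<omega>) -` A \<inter> space P0 | A. A \<in> sets ?F} = sets ?F"
    proof (intro set_eqI iffI)
      fix A assume "A \<in> sets ?F"
      moreover from this have "(\<lambda>\<omega>. \<omega>) -` A \<inter> space P0 = A"
        using sets.sets_into_space[of A ?F] by (auto simp: space_law)
      ultimately show "A \<in> {(\<lambda>\<omega>. \<omega>) -` A \<inter> space P0 | A. A \<in> sets ?F}" by blast
    next
      fix A assume "A \<in> {(\<lambda>\<omega>. \<omega>) -` A \<inter> space P0 | A. A \<in> sets ?F}"
      then obtain C where "A = C \<inter> space ?F" "C \<in> sets ?F" by (auto simp: space_law)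
      then show "A \<in> sets ?F" using sets.Int_space_eq2[of C ?F] by simp
    qed
    then show ?thesis
      using sets.sigma_sets_eq[of ?F] by (simp add: sets_vimage_algebra space_law)
  qed
  then have "indep_set (sets (vimage_algebra (space P0) (\<lambda>\<omega>. \<omega>) ?F)) (sets (vimage_algebra (space P0) ?Y borel))"
    using independent_increments[of s "s + u"] s u by simp
  from indep_set_joint_law[OF id_F Y this]
  have joint: "distr P0 (?F \<Otimes>\<^sub>M borel) (\<lambda>\<omega>. (\<omega>, ?Y \<omega>)) = distr P0 ?F (\<lambda>\<omega>. \<omega>) \<Otimes>\<^sub>M distr P0 borel (coord u)"
    using stationary_increments[of s "s + u"] s u by simp
  interpret D: prob_space "distr P0 borel (coord u)"
    by (rule prob_space_distr) measurable
  \<comment> \<open>The indicator of the event, as a function of the path up to time \<open>s\<close> and of the increment.\<close>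
  define f :: "path \<times> real \<Rightarrow> ennreal" where "f = (\<lambda>z. indicator B (fst z) * indicator {..c} (coord s (fst z) + snd z))"
  have f[measurable]: "f \<in> borel_measurable (?F \<Otimes>\<^sub>M borel)"
    unfolding f_def by measurable
  have "(\<integral>\<^sup>+\<omega>. indicator B \<omega> * indicator {\<omega>. coord (s + u) \<omega> \<le> c} \<omega> \<partial>P0) = (\<integral>\<^sup>+\<omega>. f (\<omega>, ?Y \<omega>) \<partial>P0)"
    by (intro nn_integral_cong) (auto simp: f_def indicator_def)
  also have "\<dots> = (\<integral>\<^sup>+z. f z \<partial>distr P0 (?F \<Otimes>\<^sub>M borel) (\<lambda>\<omega>. (\<omega>, ?Y \<omega>)))"
    by (rule nn_integral_distr[symmetric]) (use id_F f in measurable)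
  also have "\<dots> = (\<integral>\<^sup>+\<omega>. \<integral>\<^sup>+y. f (\<omega>, y) \<partial>distr P0 borel (coord u) \<partial>distr P0 ?F (\<lambda>\<omega>. \<omega>))"
    unfolding joint by (rule D.nn_integral_fst[symmetric]) measurable
  also have "\<dots> = (\<integral>\<^sup>+\<omega>. \<integral>\<^sup>+y. f (\<omega>, y) \<partial>distr P0 borel (coord u) \<partial>P0)"
    by (rule nn_integral_distr[OF id_F]) measurable
  also have "\<dots> = (\<integral>\<^sup>+\<omega>. \<integral>\<^sup>+\<omega>'. f (\<omega>, coord u \<omega>') \<partial>P0 \<partial>P0)"
  proof (rule nn_integral_cong)
    fix \<omega> assume "\<omega> \<in> space P0"
    then have [simp]: "\<omega> \<in> space ?F" by (simp add: space_law)
    show "(\<integral>\<^sup>+y. f (\<omega>, y) \<partial>distr P0 borel (coord u)) = (\<integral>\<^sup>+\<omega>'. f (\<omega>, coord u \<omega>') \<partial>P0)"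
      by (rule nn_integral_distr[OF coord_random_variable[OF u]])
         (use measurable_compose[OF measurable_Pair1'[OF \<open>\<omega> \<in> space ?F\<close>] f] in simp)
  qed
  also have "\<dots> = (\<integral>\<^sup>+\<omega>. indicator B \<omega> * (\<integral>\<^sup>+\<omega>'. indicator {\<omega>'. coord u \<omega>' \<le> c - coord s \<omega>} \<omega>' \<partial>P0) \<partial>P0)"
    by (intro nn_integral_cong) (auto simp: f_def indicator_def algebra_simps intro!: nn_integral_cong)
  finally show ?thesis .
qed

text \<open>
  Integrating the Markov property over \<open>u\<close> turns the left-hand side into the expected time spent below
  \<open>c\<close> after time \<open>s\<close>, that is, the residual passage time, and the right-hand side into the renewal
  function at the remaining distance.
\<close>

lemma expected_residual_passage_time:
  assumes s: "0 \<le> s" and B: "B \<in> sets (natural_filtration (ennreal s))"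
  shows "(\<integral>\<^sup>+\<omega>. indicator B \<omega> * (first_passage_above c \<omega> - ennreal s) \<partial>P0)
    = (\<integral>\<^sup>+\<omega>. indicator B \<omega> * renewal_function P0 (c - coord s \<omega>) \<partial>P0)"
proof -
  interpret pair_sigma_finite lborel P0 by unfold_locales
  have [measurable]: "B \<in> sets P0"
    using sets_natural_filtration_path_space[OF B] by (simp add: sets_law)
  have "(\<integral>\<^sup>+\<omega>. indicator B \<omega> * (first_passage_above c \<omega> - ennreal s) \<partial>P0)
      = (\<integral>\<^sup>+\<omega>. indicator B \<omega> * (\<integral>\<^sup>+u. indicator {0..} u * indicator {..c} (position (s + u) \<omega>) \<partial>lborel) \<partial>P0)"
    using first_passage_occupation
  proof (intro nn_integral_cong_AE, eventually_elim)
    case (elim \<omega>)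
    have "(\<integral>\<^sup>+u. indicator {0..} u * indicator {..c} (position (s + u) \<omega>) \<partial>lborel)
        = (\<integral>\<^sup>+u. indicator {0..} u * indicator {\<omega>. coord (s + u) \<omega> \<le> c} \<omega> \<partial>lborel)"
      using s by (intro nn_integral_cong) (auto simp: s indicator_def)
    then show ?case using elim s by simp
  qed
  also have "\<dots> = (\<integral>\<^sup>+\<omega>. \<integral>\<^sup>+u. indicator B \<omega> * (indicator {0..} u * indicator {..c} (position (s + u) \<omega>)) \<partial>lborel \<partial>P0)"
  proof (intro nn_integral_cong nn_integral_cmult[symmetric])
    fix \<omega> assume "\<omega> \<in> space P0"
    then have [simp]: "\<omega> \<in> cadlag_paths" by (simp add: space_law)
    show "(\<lambda>u. indicator {0..} u * indicator {..c} (position (s + u) \<omega>) :: ennreal) \<in> borel_measurable lborel"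
      by measurable
  qed
  also have "\<dots> = (\<integral>\<^sup>+u. \<integral>\<^sup>+\<omega>. indicator B \<omega> * (indicator {0..} u * indicator {..c} (position (s + u) \<omega>)) \<partial>P0 \<partial>lborel)"
    by (rule Fubini') measurable
  also have "\<dots> = (\<integral>\<^sup>+u. indicator {0..} u * (\<integral>\<^sup>+\<omega>. indicator B \<omega> * indicator {\<omega>. coord (s + u) \<omega> \<le> c} \<omega> \<partial>P0) \<partial>lborel)"
    using s by (intro nn_integral_cong) (auto simp: s indicator_def intro!: nn_integral_cong)
  also have "\<dots> = (\<integral>\<^sup>+u. indicator {0..} u * (\<integral>\<^sup>+\<omega>. indicator B \<omega> *
      (\<integral>\<^sup>+\<omega>'. indicator {\<omega>'. coord u \<omega>' \<le> c - coord s \<omega>} \<omega>' \<partial>P0) \<partial>P0) \<partial>lborel)"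
    by (intro nn_integral_cong) (auto simp: s indicator_def[of "{0..}"] markov_at_fixed_time[OF s _ B])
  also have "\<dots> = (\<integral>\<^sup>+u. \<integral>\<^sup>+\<omega>. indicator B \<omega> * (indicator {0..} u *
      (\<integral>\<^sup>+\<omega>'. indicator {..c} (position s \<omega> + position u \<omega>') \<partial>P0)) \<partial>P0 \<partial>lborel)"
    by (intro nn_integral_cong) (auto simp: s indicator_def algebra_simps intro!: nn_integral_cong)
  also have "\<dots> = (\<integral>\<^sup>+\<omega>. \<integral>\<^sup>+u. indicator B \<omega> * (indicator {0..} u *
      (\<integral>\<^sup>+\<omega>'. indicator {..c} (position s \<omega> + position u \<omega>') \<partial>P0)) \<partial>lborel \<partial>P0)"
    by (rule Fubini'[symmetric]) measurable
  also have "\<dots> = (\<integral>\<^sup>+\<omega>. indicator B \<omega> * renewal_function P0 (c - coord s \<omega>) \<partial>P0)"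
  proof (intro nn_integral_cong)
    fix \<omega> assume "\<omega> \<in> space P0"
    then have [simp]: "\<omega> \<in> cadlag_paths" by (simp add: space_law)
    have "(\<integral>\<^sup>+u. indicator B \<omega> * (indicator {0..} u *
        (\<integral>\<^sup>+\<omega>'. indicator {..c} (position s \<omega> + position u \<omega>') \<partial>P0)) \<partial>lborel)
      = indicator B \<omega> * (\<integral>\<^sup>+u. indicator {0..} u *
        (\<integral>\<^sup>+\<omega>'. indicator {..c} (position s \<omega> + position u \<omega>') \<partial>P0) \<partial>lborel)"
      by (rule nn_integral_cmult) measurable
    also have "(\<integral>\<^sup>+u. indicator {0..} u * (\<integral>\<^sup>+\<omega>'. indicator {..c} (position s \<omega> + position u \<omega>') \<partial>P0) \<partial>lborel)
      = renewal_function P0 (c - coord s \<omega>)"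
      unfolding renewal_function_alt
      by (intro nn_integral_cong) (auto simp: s indicator_def algebra_simps intro!: nn_integral_cong)
    finally show "(\<integral>\<^sup>+u. indicator B \<omega> * (indicator {0..} u *
        (\<integral>\<^sup>+\<omega>'. indicator {..c} (position s \<omega> + position u \<omega>') \<partial>P0)) \<partial>lborel)
      = indicator B \<omega> * renewal_function P0 (c - coord s \<omega>)" .
  qed
  finally show ?thesis .
qed

text \<open>
  This is the residual passage time formula at \<open>s = 0\<close>, with the whole path space as the event.
\<close>

lemma expected_passage_time: "(\<integral>\<^sup>+\<omega>. first_passage_above c \<omega> \<partial>P0) = renewal_function P0 c"
proof -
  have "(\<integral>\<^sup>+\<omega>. first_passage_above c \<omega> \<partial>P0) =
      (\<integral>\<^sup>+\<omega>. indicator cadlag_paths \<omega> * (first_passage_above c \<omega> - ennreal 0) \<partial>P0)"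
    by (intro nn_integral_cong) (auto simp: indicator_def space_law)
  also have "\<dots> = (\<integral>\<^sup>+\<omega>. indicator cadlag_paths \<omega> * renewal_function P0 (c - coord 0 \<omega>) \<partial>P0)"
    by (rule expected_residual_passage_time) (use sets.top[of "natural_filtration 0"] in auto)
  also have "\<dots> = (\<integral>\<^sup>+\<omega>. renewal_function P0 c \<partial>P0)"
    using AE_regular by (intro nn_integral_cong_AE, eventually_elim) simp
  finally show ?thesis by (simp add: emeasure_space_1)
qed

end

section \<open>The subordinator started from an arbitrary point\<close>

lemma topspace_cemetery [simp]: "topspace cemetery_topology = UNIV"
  using openin_subset[of cemetery_topology UNIV] by auto

lemma translation_continuous: "continuous_map cemetery_topology cemetery_topology (map_option (\<lambda>y. x + y))"
proof (unfold continuous_map_def, intro conjI allI impI)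
  fix U :: "real option set" assume "openin cemetery_topology U"
  then have "open ((\<lambda>y. x + y) -` (Some -` U))"
    by (intro continuous_open_vimage) (auto intro!: continuous_intros)
  then show "openin cemetery_topology {z \<in> topspace cemetery_topology. map_option (\<lambda>y. x + y) z \<in> U}"
    by (simp add: vimage_def)
qed simp

lemma translation_measurable: "map_option (\<lambda>y. x + y) \<in> cemetery_borel \<rightarrow>\<^sub>M cemetery_borel"
proof (rule measurable_sigma_sets)
  show "sets cemetery_borel = sigma_sets UNIV {U. openin cemetery_topology U}"
    by (simp add: cemetery_borel_def)
  fix U assume "U \<in> {U. openin cemetery_topology U}"
  then have "openin cemetery_topology (map_option (\<lambda>y. x + y) -` U)"
    using translation_continuous[of x] by (simp add: continuous_map_def vimage_def)
  then show "map_option (\<lambda>y. x + y) -` U \<inter> space cemetery_borel \<in> sets cemetery_borel"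
    by (auto intro: open_cemetery_borel)
qed auto

lemma shift_path_eq_None_iff: "0 \<le> t \<Longrightarrow> shift_path x \<omega> t = None \<longleftrightarrow> \<omega> t = None"
  by (simp add: shift_path_def)

lemma lifetime_shift_path [simp]: "lifetime (shift_path x \<omega>) = lifetime \<omega>"
proof -
  have "{t. 0 \<le> t \<and> shift_path x \<omega> t = None} = {t. 0 \<le> t \<and> \<omega> t = None}"
    using shift_path_eq_None_iff by blast
  then show ?thesis by (simp add: lifetime_def)
qed

lemma shift_path_cadlag:
  assumes "\<omega> \<in> cadlag_paths"
  shows "shift_path x \<omega> \<in> cadlag_paths"
proof -
  have eq: "shift_path x \<omega> s = map_option (\<lambda>y. x + y) (\<omega> s)" if "0 \<le> s" for s
    using that by (simp add: shift_path_def)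
  have lim: "limitin cemetery_topology (shift_path x \<omega>) (map_option (\<lambda>y. x + y) l) F"
    if "limitin cemetery_topology \<omega> l F" "\<forall>\<^sub>F s in F. 0 \<le> s" for l F
  proof (rule limitin_transform_eventually)
    show "limitin cemetery_topology (map_option (\<lambda>y. x + y) \<circ> \<omega>) (map_option (\<lambda>y. x + y) l) F"
      by (rule continuous_map_limit[OF translation_continuous that(1)])
    show "\<forall>\<^sub>F s in F. (map_option (\<lambda>y. x + y) \<circ> \<omega>) s = shift_path x \<omega> s"
      using that(2) by eventually_elim (simp add: eq)
  qed
  show ?thesis
    unfolding cadlag_paths_def mem_Collect_eq
  proof (intro conjI allI impI)
    show "shift_path x \<omega> \<in> extensional {0..}" by (simp add: shift_path_def)
  next
    fix t :: real assume t: "0 \<le> t"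
    have "\<forall>\<^sub>F s in at_right t. 0 \<le> s"
      using eventually_at_right_less[of t] by eventually_elim (use t in simp)
    then show "limitin cemetery_topology (shift_path x \<omega>) (shift_path x \<omega> t) (at_right t)"
      using assms t by (auto simp: eq cadlag_paths_def intro!: lim)
  next
    fix t :: real assume t: "0 < t"
    have "\<forall>\<^sub>F s in at_left t. 0 \<le> s"
      using eventually_at_left_field t by (metis less_imp_le)
    then show "\<exists>l. limitin cemetery_topology (shift_path x \<omega>) l (at_left t)"
      using assms t lim unfolding cadlag_paths_def by blast
  next
    fix t :: real assume "0 \<le> t" "lifetime (shift_path x \<omega>) \<le> ennreal t"
    then show "shift_path x \<omega> t = None"
      using assms by (simp add: shift_path_eq_None_iff lifetime_le_iff)
  qed
qed

lemma shift_path_measurable_filtration: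
  "shift_path x \<in> natural_filtration t \<rightarrow>\<^sub>M natural_filtration t"
proof (rule measurable_sigma_sets[OF sets_natural_filtration])
  fix C assume "C \<in> {{\<omega> \<in> cadlag_paths. \<omega> s \<in> B} | s B. 0 \<le> s \<and> ennreal s \<le> t \<and> B \<in> sets cemetery_borel}"
  then obtain s B where C: "C = {\<omega> \<in> cadlag_paths. \<omega> s \<in> B}" "0 \<le> s" "ennreal s \<le> t" "B \<in> sets cemetery_borel"
    by blast
  have "shift_path x -` C \<inter> space (natural_filtration t)
      = (\<lambda>\<omega>. map_option (\<lambda>y. x + y) (\<omega> s)) -` B \<inter> space (natural_filtration t)"
    using C shift_path_cadlag by (auto simp: shift_path_def)
  also have "\<dots> \<in> sets (natural_filtration t)"
    by (rule measurable_sets[OF measurable_compose[OF evaluation_measurable translation_measurable]]) (use C in auto)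
  finally show "shift_path x -` C \<inter> space (natural_filtration t) \<in> sets (natural_filtration t)" .
qed (auto intro: shift_path_cadlag)

lemma first_passage_shift_path [simp]:
  "first_passage_above b (shift_path x \<omega>) = first_passage_above (b - x) \<omega>"
proof -
  have "{t. 0 \<le> t \<and> (\<exists>y>b. shift_path x \<omega> t = Some y)} = {t. 0 \<le> t \<and> (\<exists>y>b - x. \<omega> t = Some y)}"
    by (auto simp: shift_path_def)
  then show ?thesis by (simp add: first_passage_above_def)
qed

context subordinator
begin

lemma shift_path_random_variable [measurable]: "shift_path x \<in> P0 \<rightarrow>\<^sub>M path_space"
  using shift_path_measurable_filtration[of x \<infinity>] by (simp cong: measurable_cong_sets add: sets_law)

lemma sets_started_from [simp, measurable_cong]: "sets (started_from P0 x) = sets path_space"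
  by (simp add: started_from_def)

lemma expected_passage_time_started_from:
  "(\<integral>\<^sup>+\<omega>. first_passage_above a \<omega> \<partial>started_from P0 x) = renewal_function P0 (a - x)"
proof -
  have "(\<integral>\<^sup>+\<omega>. first_passage_above a \<omega> \<partial>started_from P0 x) =
      (\<integral>\<^sup>+\<omega>. first_passage_above a (shift_path x \<omega>) \<partial>P0)"
    unfolding started_from_def by (rule nn_integral_distr) measurable
  then show ?thesis by (simp add: expected_passage_time)
qed

text \<open>
  The claim for the deterministic time \<open>t\<close>: the weight \<open>U(a - X\<^sub>t)\<close> of the \<open>h\<close>-transform is
  the conditional expectation of the residual passage time. The event \<open>B\<close> in the proof is \<open>A\<close>
  translated to paths started from \<open>0\<close>.
\<close>

lemma h_transform_fixed_time:
  assumes Q: "is_h_transform_law P0 a x Q" and t: "0 \<le> t"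
    and A: "A \<in> sets (natural_filtration (ennreal t))"
  shows "emeasure Q {\<omega> \<in> A. ennreal t < lifetime \<omega>} =
    (\<integral>\<^sup>+\<omega>. indicator A \<omega> * (first_passage_above a \<omega> - ennreal t) \<partial>started_from P0 x)
      / renewal_function P0 (a - x)"
proof -
  let ?U = "renewal_function P0"
  define B where "B = shift_path x -` A \<inter> space (natural_filtration (ennreal t))"
  have B: "B \<in> sets (natural_filtration (ennreal t))"
    unfolding B_def by (rule measurable_sets[OF shift_path_measurable_filtration A])
  have [measurable]: "A \<in> sets path_space" "B \<in> sets P0"
    using sets_natural_filtration_path_space[OF A] sets_natural_filtration_path_space[OF B]
    by (simp_all add: sets_law)
  note [measurable] = coord_measurable[OF t] coord_random_variable[OF t]
  have low: "{\<omega>. \<exists>y\<le>a. \<omega> t = Some y} \<inter> A \<in> sets path_space"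
  proof -
    have "{\<omega>. \<exists>y\<le>a. \<omega> t = Some y} \<inter> A = {\<omega> \<in> cadlag_paths. \<exists>y\<le>a. \<omega> t = Some y} \<inter> A"
      using sets.sets_into_space[OF A] by auto
    then show ?thesis
      using sets.Int[OF below_level_sets(1)[OF t, of \<infinity> a]] sets_natural_filtration_path_space[OF A] by simp
  qed
  note [measurable] = low
  have "emeasure Q {\<omega> \<in> A. ennreal t < lifetime \<omega>} =
      (\<integral>\<^sup>+\<omega>. ?U (a - coord t \<omega>) / ?U (a - x) * indicator ({\<omega>. \<exists>y\<le>a. \<omega> t = Some y} \<inter> A) \<omega> \<partial>started_from P0 x)"
    using Q t A unfolding is_h_transform_law_def by blast
  also have "\<dots> = (\<integral>\<^sup>+\<omega>. ?U (a - coord t (shift_path x \<omega>)) / ?U (a - x) *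
      indicator ({\<omega>. \<exists>y\<le>a. \<omega> t = Some y} \<inter> A) (shift_path x \<omega>) \<partial>P0)"
    unfolding started_from_def by (rule nn_integral_distr) measurable
  also have "\<dots> = (\<integral>\<^sup>+\<omega>. indicator B \<omega> * ?U ((a - x) - coord t \<omega>) / ?U (a - x) \<partial>P0)"
    using AE_regular
  proof (intro nn_integral_cong_AE, eventually_elim)
    case (elim \<omega>)
    have 1: "shift_path x \<omega> t = Some (x + coord t \<omega>)"
      using elim t by (metis (mono_tags) atLeast_iff option.map(2) restrict_apply shift_path_def)
    then have 2: "coord t (shift_path x \<omega>) = x + coord t \<omega>"
      by (simp add: coord_def)
    have 3: "\<omega> \<in> B \<longleftrightarrow> shift_path x \<omega> \<in> A"
      using elim by (simp add: B_def)
    show ?case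
      using renewal_function_negative[of "(a - x) - coord t \<omega>"]
      by (auto simp: 1 2 3 indicator_def algebra_simps)
  qed
  also have "\<dots> = (\<integral>\<^sup>+\<omega>. indicator B \<omega> * ?U ((a - x) - coord t \<omega>) \<partial>P0) / ?U (a - x)"
    by (rule nn_integral_divide) measurable
  also have "\<dots> = (\<integral>\<^sup>+\<omega>. indicator B \<omega> * (first_passage_above (a - x) \<omega> - ennreal t) \<partial>P0) / ?U (a - x)"
    by (simp add: expected_residual_passage_time[OF t B])
  also have "(\<integral>\<^sup>+\<omega>. indicator B \<omega> * (first_passage_above (a - x) \<omega> - ennreal t) \<partial>P0) =
      (\<integral>\<^sup>+\<omega>. indicator A (shift_path x \<omega>) * (first_passage_above a (shift_path x \<omega>) - ennreal t) \<partial>P0)"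
    by (intro nn_integral_cong) (auto simp: B_def indicator_def space_law)
  also have "\<dots> = (\<integral>\<^sup>+\<omega>. indicator A \<omega> * (first_passage_above a \<omega> - ennreal t) \<partial>started_from P0 x)"
    unfolding started_from_def by (rule nn_integral_distr[symmetric]) measurable
  finally show ?thesis .
qed

end

section \<open>From fixed times to stopping times\<close>

text \<open>
  The least multiple of \<open>1 / (n + 1)\<close> strictly above \<open>v\<close>: the usual approximation of a stopping time
  from above by stopping times with countably many values.
\<close>

definition round_up :: "nat \<Rightarrow> ennreal \<Rightarrow> ennreal" where
  "round_up n v = (if v = \<top> then \<top>
     else ennreal ((real (nat \<lfloor>real (Suc n) * enn2real v\<rfloor>) + 1) / real (Suc n)))"

lemma round_up_top [simp]: "round_up n \<top> = \<top>"
  by (simp add: round_up_def)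

lemma grid_point_eq_iff:
  "ennreal ((real i + 1) / real (Suc n)) = ennreal ((real j + 1) / real (Suc n)) \<longleftrightarrow> i = j"
  by (simp add: field_simps del: of_nat_Suc)

lemma round_up_eq_iff:
  "round_up n v = ennreal ((real k + 1) / real (Suc n)) \<longleftrightarrow>
    ennreal (real k / real (Suc n)) \<le> v \<and> v < ennreal ((real k + 1) / real (Suc n))"
proof (cases v)
  case (real r)
  have "round_up n v = ennreal ((real (nat \<lfloor>real (Suc n) * r\<rfloor>) + 1) / real (Suc n))"
    by (simp only: round_up_def real(2) ennreal_neq_top if_False enn2real_ennreal[OF real(1)])
  then have "round_up n v = ennreal ((real k + 1) / real (Suc n)) \<longleftrightarrow> nat \<lfloor>real (Suc n) * r\<rfloor> = k"
    by (simp only: grid_point_eq_iff)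
  also have "\<dots> \<longleftrightarrow> \<lfloor>real (Suc n) * r\<rfloor> = int k"
    using real(1) by (metis int_nat_eq mult_nonneg_nonneg nat_int of_nat_0_le_iff zero_le_floor)
  also have "\<dots> \<longleftrightarrow> real k \<le> real (Suc n) * r \<and> real (Suc n) * r < real k + 1"
    by (simp add: floor_eq_iff)
  also have "\<dots> \<longleftrightarrow> ennreal (real k / real (Suc n)) \<le> v \<and> v < ennreal ((real k + 1) / real (Suc n))"
    using real by (simp add: ennreal_less_iff field_simps del: of_nat_Suc)
  finally show ?thesis .
qed simp

lemma round_up_grid:
  assumes "v \<noteq> \<top>"
  obtains k where "round_up n v = ennreal ((real k + 1) / real (Suc n))"
  by (rule that[of "nat \<lfloor>real (Suc n) * enn2real v\<rfloor>"]) (simp only: round_up_def assms if_False)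

lemma less_round_up: "v \<noteq> \<top> \<Longrightarrow> v < round_up n v"
  by (metis round_up_eq_iff round_up_grid)

lemma round_up_tendsto: "(\<lambda>n. round_up n v) \<longlonglongrightarrow> v"
proof (cases v)
  case (real r)
  have le: "round_up n v \<le> ennreal (r + 1 / real (Suc n))" for n
  proof -
    have "real (nat \<lfloor>real (Suc n) * r\<rfloor>) \<le> real (Suc n) * r"
      using real by (simp add: of_nat_nat del: of_nat_Suc)
    then have "(real (nat \<lfloor>real (Suc n) * r\<rfloor>) + 1) / real (Suc n) \<le> r + 1 / real (Suc n)"
      by (simp add: field_simps del: of_nat_Suc)
    then show ?thesis
      by (simp only: round_up_def real(2) ennreal_neq_top if_False enn2real_ennreal[OF real(1)])
         (rule ennreal_leI)
  qed
  have "(\<lambda>n. r + 1 / real (Suc n)) \<longlonglongrightarrow> r + 0"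
    by (intro tendsto_intros LIMSEQ_Suc[OF lim_1_over_n])
  then have "(\<lambda>n. ennreal (r + 1 / real (Suc n))) \<longlonglongrightarrow> ennreal (r + 0)"
    by (rule tendsto_ennrealI)
  then have "(\<lambda>n. ennreal (r + 1 / real (Suc n))) \<longlonglongrightarrow> v"
    by (simp only: real(2) add_0_right)
  with tendsto_const[of v] show ?thesis
    by (rule tendsto_sandwich[rotated 2])
       (use le less_round_up[of v] real in \<open>auto intro!: always_eventually less_imp_le\<close>)
qed simp

text \<open>
  The trace of \<open>A\<close> on a half-open range of values of \<open>T\<close> is known at the end of the range. For
  \<open>t = s + 1 / (n + 1)\<close> and \<open>s\<close> on the grid this is the event that \<open>T\<close> is rounded up to \<open>t\<close>.
\<close>

lemma stopped_set_before:
  assumes T: "stopping_time natural_filtration T" and A: "A \<in> sets (natural.pre_sigma T)"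
  shows "{\<omega> \<in> A. ennreal s \<le> T \<omega> \<and> T \<omega> < ennreal t} \<in> sets (natural_filtration (ennreal t))"
proof (cases "s \<le> t")
  case True
  have lt: "{\<omega> \<in> cadlag_paths. T \<omega> < ennreal t} \<in> sets (natural_filtration (ennreal t))" for t
    using natural.stopping_time_less_const[OF T, of "ennreal t"] by (simp add: pred_def)
  have "{\<omega> \<in> A. T \<omega> \<le> ennreal t} \<inter> {\<omega> \<in> cadlag_paths. T \<omega> < ennreal t} - {\<omega> \<in> cadlag_paths. T \<omega> < ennreal s}
      \<in> sets (natural_filtration (ennreal t))"
    using natural.sets_pre_sigmaD[OF T A, of "ennreal t"] lt[of t] lt[of s]
      natural.sets_F_mono[OF ennreal_leI[OF True]] by blast
  also have "{\<omega> \<in> A. T \<omega> \<le> ennreal t} \<inter> {\<omega> \<in> cadlag_paths. T \<omega> < ennreal t} - {\<omega> \<in> cadlag_paths. T \<omega> < ennreal s}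
      = {\<omega> \<in> A. ennreal s \<le> T \<omega> \<and> T \<omega> < ennreal t}"
    using sets.sets_into_space[OF A] by (auto simp: natural.space_pre_sigma)
  finally show ?thesis .
next
  case False
  then have "ennreal t \<le> ennreal s" by (simp add: ennreal_leI)
  then have "{\<omega> \<in> A. ennreal s \<le> T \<omega> \<and> T \<omega> < ennreal t} = {}"
    by (metis (mono_tags, lifting) Collect_empty_eq leD order_trans)
  then show ?thesis by (simp only: sets.empty_sets)
qed

text \<open>
  At most one term of the sum is non-zero, the one of the grid value of the rounded time. Paths with \<open>T \<omega> = \<infinity>\<close> belong to
  none of the events in the sum, so \<open>g\<close> has to vanish at \<open>\<infinity>\<close>.
\<close>

lemma grid_sum:
  assumes "g \<top> = 0"
  shows "(\<Sum>k. g (ennreal ((real k + 1) / real (Suc n))) *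
      indicator {\<omega> \<in> A. round_up n (T \<omega>) = ennreal ((real k + 1) / real (Suc n))} \<omega>)
    = indicator A \<omega> * (g (round_up n (T \<omega>)) :: ennreal)"
proof (cases "\<omega> \<in> A \<and> T \<omega> \<noteq> \<top>")
  case True
  then obtain k where k: "round_up n (T \<omega>) = ennreal ((real k + 1) / real (Suc n))"
    using round_up_grid by blast
  show ?thesis
    using True k
    by (subst suminf_cmult_indicator[where i = k]) (auto simp: disjoint_family_on_def grid_point_eq_iff simp del: of_nat_Suc)
next
  case False
  then have "\<omega> \<in> A \<Longrightarrow> T \<omega> = \<top>" by auto
  with assms show ?thesis by (auto simp: indicator_def)
qed

text \<open>
  For the rounded time the identity is a countable sum of its fixed-time instances. As the mesh
  decreases, the indicator of \<open>round_up n (T \<omega>) < lifetime \<omega>\<close> is eventually equal to that of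
  \<open>T \<omega> < lifetime \<omega>\<close>, while the residuals converge and are dominated by \<open>D\<close>.
\<close>

lemma stopping_time_identity:
  assumes Q: "prob_space Q" "sets Q = sets path_space"
    and R: "sets R = sets path_space"
    and D: "D \<in> borel_measurable path_space" and fin: "(\<integral>\<^sup>+\<omega>. D \<omega> \<partial>R) < \<infinity>"
    and fixed: "\<And>t A. 0 \<le> t \<Longrightarrow> A \<in> sets (natural_filtration (ennreal t)) \<Longrightarrow>
      emeasure Q {\<omega> \<in> A. ennreal t < lifetime \<omega>} = (\<integral>\<^sup>+\<omega>. indicator A \<omega> * (D \<omega> - ennreal t) \<partial>R) / c"
    and c: "c \<noteq> 0"
    and T: "stopping_time natural_filtration T" and A: "A \<in> sets (natural.pre_sigma T)"
  shows "emeasure Q {\<omega> \<in> A. T \<omega> < lifetime \<omega>} = (\<integral>\<^sup>+\<omega>. indicator A \<omega> * (D \<omega> - T \<omega>) \<partial>R) / c"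
proof -
  interpret Q: prob_space Q by (rule Q)
  note [measurable_cong] = Q(2) R
  note [measurable] = D
  have "T \<in> borel_measurable path_space"
    by (rule measurable_stopping_time[OF T]) (auto simp: natural.sets_F_mono)
  note [measurable] = this
  have [measurable]: "A \<in> sets path_space"
    using natural.sets_pre_sigmaD[OF T A, of \<infinity>] by simp
  have [measurable]: "round_up n \<in> borel_measurable borel" for n
    unfolding round_up_def by measurable
  define t where "t n k = (real k + 1) / real (Suc n)" for n k :: nat
  define B where "B n k = {\<omega> \<in> A. round_up n (T \<omega>) = ennreal (t n k)}" for n k
  have t_nonneg: "0 \<le> t n k" for n k by (simp add: t_def)
  have B: "B n k \<in> sets (natural_filtration (ennreal (t n k)))" for n k
    using stopped_set_before[OF T A, of "real k / real (Suc n)" "t n k"]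
    unfolding B_def t_def round_up_eq_iff .
  have [measurable]: "B n k \<in> sets path_space" for n k
    by (rule sets_natural_filtration_path_space[OF B])
  have D_finite: "AE \<omega> in R. D \<omega> \<noteq> \<top>"
    using nn_integral_PInf_AE[of D R] fin by simp
  let ?alive = "\<lambda>\<omega> v. if v < lifetime \<omega> then 1 else 0 :: ennreal"
  have grid: "(\<integral>\<^sup>+\<omega>. indicator A \<omega> * ?alive \<omega> (round_up n (T \<omega>)) \<partial>Q)
      = (\<integral>\<^sup>+\<omega>. indicator A \<omega> * (D \<omega> - round_up n (T \<omega>)) \<partial>R) / c" for n
  proof -
    have "(\<integral>\<^sup>+\<omega>. indicator A \<omega> * ?alive \<omega> (round_up n (T \<omega>)) \<partial>Q)
        = (\<integral>\<^sup>+\<omega>. (\<Sum>k. ?alive \<omega> (ennreal (t n k)) * indicator (B n k) \<omega>) \<partial>Q)"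
      unfolding B_def t_def by (subst grid_sum) (auto simp: top_unique)
    also have "\<dots> = (\<Sum>k. \<integral>\<^sup>+\<omega>. ?alive \<omega> (ennreal (t n k)) * indicator (B n k) \<omega> \<partial>Q)"
      by (rule nn_integral_suminf) measurable
    also have "\<dots> = (\<Sum>k. emeasure Q {\<omega> \<in> B n k. ennreal (t n k) < lifetime \<omega>})"
    proof (intro arg_cong[where f = suminf] ext)
      fix k
      have "(\<integral>\<^sup>+\<omega>. ?alive \<omega> (ennreal (t n k)) * indicator (B n k) \<omega> \<partial>Q)
          = (\<integral>\<^sup>+\<omega>. indicator {\<omega> \<in> B n k. ennreal (t n k) < lifetime \<omega>} \<omega> \<partial>Q)"
        by (intro nn_integral_cong) (auto simp: indicator_def)
      also have "\<dots> = emeasure Q {\<omega> \<in> B n k. ennreal (t n k) < lifetime \<omega>}"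
        by (rule nn_integral_indicator) measurable
      finally show "(\<integral>\<^sup>+\<omega>. ?alive \<omega> (ennreal (t n k)) * indicator (B n k) \<omega> \<partial>Q)
          = emeasure Q {\<omega> \<in> B n k. ennreal (t n k) < lifetime \<omega>}" .
    qed
    also have "\<dots> = (\<Sum>k. (\<integral>\<^sup>+\<omega>. (D \<omega> - ennreal (t n k)) * indicator (B n k) \<omega> \<partial>R) / c)"
      by (simp add: fixed[OF t_nonneg B] mult.commute)
    also have "\<dots> = (\<Sum>k. \<integral>\<^sup>+\<omega>. (D \<omega> - ennreal (t n k)) * indicator (B n k) \<omega> \<partial>R) / c"
      by (simp add: divide_ennreal_def ennreal_suminf_multc)
    also have "(\<Sum>k. \<integral>\<^sup>+\<omega>. (D \<omega> - ennreal (t n k)) * indicator (B n k) \<omega> \<partial>R)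
        = (\<integral>\<^sup>+\<omega>. (\<Sum>k. (D \<omega> - ennreal (t n k)) * indicator (B n k) \<omega>) \<partial>R)"
      by (rule nn_integral_suminf[symmetric]) measurable
    also have "\<dots> = (\<integral>\<^sup>+\<omega>. indicator A \<omega> * (D \<omega> - round_up n (T \<omega>)) \<partial>R)"
      using D_finite
    proof (intro nn_integral_cong_AE, eventually_elim)
      case (elim \<omega>)
      then show ?case
        unfolding B_def t_def
        by (intro grid_sum[where g = "\<lambda>v. D \<omega> - v"]) (simp add: diff_eq_0_iff_ennreal less_top)
    qed
    finally show ?thesis .
  qed
  have "(\<lambda>n. \<integral>\<^sup>+\<omega>. indicator A \<omega> * ?alive \<omega> (round_up n (T \<omega>)) \<partial>Q)
      \<longlonglongrightarrow> (\<integral>\<^sup>+\<omega>. indicator A \<omega> * ?alive \<omega> (T \<omega>) \<partial>Q)"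
  proof (rule nn_integral_dominated_convergence[where w = "\<lambda>_. 1"])
    show "AE \<omega> in Q. (\<lambda>n. indicator A \<omega> * ?alive \<omega> (round_up n (T \<omega>))) \<longlonglongrightarrow> indicator A \<omega> * ?alive \<omega> (T \<omega>)"
    proof (rule AE_I2)
      fix \<omega>
      have "\<forall>\<^sub>F n in sequentially. ?alive \<omega> (round_up n (T \<omega>)) = ?alive \<omega> (T \<omega>)"
      proof (cases "T \<omega> < lifetime \<omega>")
        case True
        then have "\<forall>\<^sub>F n in sequentially. round_up n (T \<omega>) < lifetime \<omega>"
          by (rule order_tendstoD(2)[OF round_up_tendsto])
        then show ?thesis by eventually_elim (simp add: True)
      next
        case False
        then have "\<not> round_up n (T \<omega>) < lifetime \<omega>" for n
          using less_round_up[of "T \<omega>" n] by (cases "T \<omega> = \<top>") auto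
        then show ?thesis using False by simp
      qed
      then have "\<forall>\<^sub>F n in sequentially. indicator A \<omega> * ?alive \<omega> (round_up n (T \<omega>)) = indicator A \<omega> * ?alive \<omega> (T \<omega>)"
        by eventually_elim simp
      then show "(\<lambda>n. indicator A \<omega> * ?alive \<omega> (round_up n (T \<omega>))) \<longlonglongrightarrow> indicator A \<omega> * ?alive \<omega> (T \<omega>)"
        by (rule tendsto_eventually)
    qed
  qed (auto simp: indicator_def Q.emeasure_space_1)
  moreover have "(\<lambda>n. \<integral>\<^sup>+\<omega>. indicator A \<omega> * (D \<omega> - round_up n (T \<omega>)) \<partial>R)
      \<longlonglongrightarrow> (\<integral>\<^sup>+\<omega>. indicator A \<omega> * (D \<omega> - T \<omega>) \<partial>R)"
  proof (rule nn_integral_dominated_convergence[where w = D])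
    show "AE \<omega> in R. (\<lambda>n. indicator A \<omega> * (D \<omega> - round_up n (T \<omega>))) \<longlonglongrightarrow> indicator A \<omega> * (D \<omega> - T \<omega>)"
      using D_finite
    proof eventually_elim
      case (elim \<omega>)
      then show ?case
        by (intro ennreal_tendsto_cmult tendsto_diff_ennreal_general round_up_tendsto tendsto_const)
           (auto simp: indicator_def)
    qed
    show "AE \<omega> in R. indicator A \<omega> * (D \<omega> - round_up j (T \<omega>)) \<le> D \<omega>" for j
      by (auto simp: indicator_def diff_le_self_ennreal)
  qed (use fin in auto)
  then have "(\<lambda>n. (\<integral>\<^sup>+\<omega>. indicator A \<omega> * (D \<omega> - round_up n (T \<omega>)) \<partial>R) / c)
      \<longlonglongrightarrow> (\<integral>\<^sup>+\<omega>. indicator A \<omega> * (D \<omega> - T \<omega>) \<partial>R) / c"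
    unfolding divide_ennreal_def mult.commute[of _ "inverse c"] using c
    by (intro ennreal_tendsto_cmult) (auto simp: less_top[symmetric])
  ultimately have "(\<integral>\<^sup>+\<omega>. indicator A \<omega> * ?alive \<omega> (T \<omega>) \<partial>Q) = (\<integral>\<^sup>+\<omega>. indicator A \<omega> * (D \<omega> - T \<omega>) \<partial>R) / c"
    unfolding grid by (rule LIMSEQ_unique)
  moreover have "(\<integral>\<^sup>+\<omega>. indicator A \<omega> * ?alive \<omega> (T \<omega>) \<partial>Q) = (\<integral>\<^sup>+\<omega>. indicator {\<omega> \<in> A. T \<omega> < lifetime \<omega>} \<omega> \<partial>Q)"
    by (intro nn_integral_cong) (auto simp: indicator_def)
  moreover have "\<dots> = emeasure Q {\<omega> \<in> A. T \<omega> < lifetime \<omega>}"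
    by (rule nn_integral_indicator) measurable
  ultimately show ?thesis by simp
qed

section \<open>Independent exponential times of vanishing rate\<close>

text \<open>
  Divided by \<open>q\<close>, the density of the exponential law is \<open>exp(-tq)\<close> on \<open>[0, \<infinity>)\<close>, which tends
  to \<open>1\<close> and is dominated by \<open>1\<close>: seen through \<open>B\<close>, an exponential time of vanishing rate
  is distributed like Lebesgue measure.
\<close>

lemma exponential_clock_limit:
  fixes e :: "real \<Rightarrow> 'w \<Rightarrow> real" and N :: "'n measure"
  assumes M: "prob_space M" and X: "X \<in> M \<rightarrow>\<^sub>M N"
    and e: "\<And>q. 0 < q \<Longrightarrow> distributed M lborel (e q) (exponential_density q)"
    and indep: "\<And>q. 0 < q \<Longrightarrow> prob_space.indep_set M
           (sets (vimage_algebra (space M) X N)) (sets (vimage_algebra (space M) (e q) borel))"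
    and B: "B \<in> sets (N \<Otimes>\<^sub>M borel)"
    and lim: "(\<integral>\<^sup>+\<omega>. \<integral>\<^sup>+t. indicator {0..} t * indicator B (\<omega>, t) \<partial>lborel \<partial>distr M N X) = ennreal v" "0 \<le> v"
  shows "((\<lambda>q. measure M {w \<in> space M. (X w, e q w) \<in> B} / q) \<longlongrightarrow> v) (at_right 0)"
proof -
  interpret M: prob_space M by (rule M)
  let ?R = "distr M N X"
  note [measurable] = B X
  \<comment> \<open>The probability in question divided by \<open>q\<close>; dominated convergence applies on the product space.\<close>
  define J where "J q = (\<integral>\<^sup>+z. indicator {0..} (snd z) * (indicator B z * ennreal (exp (- snd z * q))) \<partial>(?R \<Otimes>\<^sub>M lborel))" for q
  have emeasure_J: "emeasure M {w \<in> space M. (X w, e q w) \<in> B} = ennreal q * J q" if q: "0 < q" for q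
  proof -
    have [measurable]: "e q \<in> borel_measurable M"
      using distributed_measurable[OF e[OF q]] by simp
    have law: "distr M borel (e q) = density lborel (exponential_density q)"
      using distributed_distr_eq_density[OF e[OF q]] by (simp cong: distr_cong)
    interpret D: prob_space "distr M borel (e q)" by (rule M.prob_space_distr) measurable
    have "emeasure M {w \<in> space M. (X w, e q w) \<in> B} = emeasure (distr M (N \<Otimes>\<^sub>M borel) (\<lambda>w. (X w, e q w))) B"
      by (subst emeasure_distr) (auto intro!: arg_cong[where f = "emeasure M"])
    also have "distr M (N \<Otimes>\<^sub>M borel) (\<lambda>w. (X w, e q w)) = ?R \<Otimes>\<^sub>M distr M borel (e q)"
      by (rule M.indep_set_joint_law[OF _ _ indep[OF q]]) measurable
    also have "emeasure (?R \<Otimes>\<^sub>M distr M borel (e q)) B = (\<integral>\<^sup>+\<omega>. \<integral>\<^sup>+t. indicator B (\<omega>, t) \<partial>distr M borel (e q) \<partial>?R)"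
      by (rule D.emeasure_pair_measure) measurable
    also have "\<dots> = (\<integral>\<^sup>+\<omega>. \<integral>\<^sup>+t. ennreal q * (indicator {0..} t * (indicator B (\<omega>, t) * ennreal (exp (- t * q)))) \<partial>lborel \<partial>?R)"
    proof (rule nn_integral_cong)
      fix \<omega> assume "\<omega> \<in> space ?R"
      then have [simp]: "\<omega> \<in> space N" by simp
      have "(\<integral>\<^sup>+t. indicator B (\<omega>, t) \<partial>distr M borel (e q)) = (\<integral>\<^sup>+t. ennreal (exponential_density q t) * indicator B (\<omega>, t) \<partial>lborel)"
        unfolding law by (rule nn_integral_density) measurable
      also have "\<dots> = (\<integral>\<^sup>+t. ennreal q * (indicator {0..} t * (indicator B (\<omega>, t) * ennreal (exp (- t * q)))) \<partial>lborel)"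
        using q by (intro nn_integral_cong) (auto simp: exponential_density_def indicator_def ennreal_mult)
      finally show "(\<integral>\<^sup>+t. indicator B (\<omega>, t) \<partial>distr M borel (e q)) =
          (\<integral>\<^sup>+t. ennreal q * (indicator {0..} t * (indicator B (\<omega>, t) * ennreal (exp (- t * q)))) \<partial>lborel)" .
    qed
    also have "\<dots> = (\<integral>\<^sup>+z. ennreal q * (indicator {0..} (snd z) * (indicator B z * ennreal (exp (- snd z * q)))) \<partial>(?R \<Otimes>\<^sub>M lborel))"
      by (subst lborel.nn_integral_fst[symmetric]) auto
    also have "\<dots> = ennreal q * J q"
      unfolding J_def by (rule nn_integral_cmult) measurable
    finally show ?thesis .
  qed
  have limit: "(\<integral>\<^sup>+z. indicator {0..} (snd z) * indicator B z \<partial>(?R \<Otimes>\<^sub>M lborel)) = ennreal v"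
    using lborel.nn_integral_fst[of "\<lambda>z. indicator {0..} (snd z) * indicator B z" ?R] lim by simp
  have "(J \<longlongrightarrow> ennreal v) (at_right 0)"
    unfolding tendsto_at_iff_sequentially
  proof (intro allI impI)
    fix Y :: "nat \<Rightarrow> real" assume Y: "\<forall>i. Y i \<in> {0<..} - {0}" "Y \<longlonglongrightarrow> 0"
    have "(\<lambda>i. J (Y i)) \<longlonglongrightarrow> (\<integral>\<^sup>+z. indicator {0..} (snd z) * indicator B z \<partial>(?R \<Otimes>\<^sub>M lborel))"
      unfolding J_def
    proof (rule nn_integral_dominated_convergence[where w = "\<lambda>z. indicator {0..} (snd z) * indicator B z"])
      show "AE z in ?R \<Otimes>\<^sub>M lborel. indicator {0..} (snd z) * (indicator B z * ennreal (exp (- snd z * Y j)))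
          \<le> indicator {0..} (snd z) * indicator B z" for j
        using Y(1) by (intro AE_I2) (auto simp: indicator_def less_imp_le)
      show "AE z in ?R \<Otimes>\<^sub>M lborel. (\<lambda>i. indicator {0..} (snd z) * (indicator B z * ennreal (exp (- snd z * Y i))))
          \<longlonglongrightarrow> indicator {0..} (snd z) * indicator B z"
      proof (rule AE_I2)
        fix z :: "'n \<times> real"
        have "(\<lambda>i. exp (- snd z * Y i)) \<longlonglongrightarrow> exp (- snd z * 0)"
          by (intro tendsto_intros Y(2))
        then have "(\<lambda>i. indicator {0..} (snd z) * (indicator B z * ennreal (exp (- snd z * Y i))))
            \<longlonglongrightarrow> indicator {0..} (snd z) * (indicator B z * ennreal (exp (- snd z * 0)))"
          by (intro ennreal_tendsto_cmult tendsto_ennrealI) (auto simp: indicator_def)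
        then show "(\<lambda>i. indicator {0..} (snd z) * (indicator B z * ennreal (exp (- snd z * Y i))))
            \<longlonglongrightarrow> indicator {0..} (snd z) * indicator B z" by simp
      qed
    qed (use limit in auto)
    then show "(J \<circ> Y) \<longlonglongrightarrow> ennreal v" by (simp add: limit comp_def)
  qed
  then have "((\<lambda>q. enn2real (J q)) \<longlongrightarrow> v) (at_right 0)"
    by (rule tendsto_enn2real) (rule lim(2))
  moreover have "\<forall>\<^sub>F q in at_right 0. enn2real (J q) = measure M {w \<in> space M. (X w, e q w) \<in> B} / q"
    using eventually_at_right_less
    by eventually_elim (simp add: measure_def emeasure_J enn2real_mult)
  ultimately show ?thesis by (rule Lim_transform_eventually)
qed

section \<open>Conditioning on late passage\<close>

theorem theorem2p2:
  fixes P0 Pdown :: "path measure" and \<kappa> :: real and \<nu> :: "real measure"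
    and a x :: real
    and M :: "'w measure" and X :: "'w \<Rightarrow> path" and e :: "real \<Rightarrow> 'w \<Rightarrow> real"
    and T :: "path \<Rightarrow> ennreal" and A :: "path set"
  assumes "subordinator P0 \<kappa> \<nu>"
    and "0 < a" and "0 \<le> x" and "x \<le> a" and "0 < renewal_function P0 (a - x)"
    and "is_h_transform_law P0 a x Pdown"
    and "prob_space M"
    and "X \<in> M \<rightarrow>\<^sub>M path_space" and "distr M path_space X = started_from P0 x"
    and "\<And>q. 0 < q \<Longrightarrow> distributed M lborel (e q) (exponential_density q)"
    and "\<And>q. 0 < q \<Longrightarrow> prob_space.indep_set M
           (sets (vimage_algebra (space M) X path_space))
           (sets (vimage_algebra (space M) (e q) borel))"
    and "stopping_time natural_filtration T"
    and "A \<in> sets (natural.pre_sigma T)"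
  shows "((\<lambda>q. \<P>(w in M. X w \<in> A \<and> T (X w) < ennreal (e q w)
              \<bar> ennreal (e q w) < first_passage_above a (X w)))
          \<longlongrightarrow> measure Pdown {\<omega> \<in> A. T \<omega> < lifetime \<omega>}) (at_right 0)"
proof -
  interpret P0: subordinator P0 \<kappa> \<nu> by (rule assms(1))
  note a_x = assms(5) and Q = assms(6) and M = assms(7) and X = assms(8) and law = assms(9)
    and e = assms(10) and indep = assms(11) and T = assms(12) and A = assms(13)
  let ?R = "started_from P0 x" and ?U = "renewal_function P0 (a - x)"
  let ?\<tau> = "first_passage_above a"
  define u where "u = enn2real ?U"
  have U: "?U = ennreal u" and u: "0 < u"
    using P0.renewal_function_finite[of "a - x"] a_x by (auto simp: u_def enn2real_positive_iff)
  have Q_prob: "prob_space Pdown" "sets Pdown = sets path_space"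
    using Q by (auto simp: is_h_transform_law_def)
  have \<tau>_int: "(\<integral>\<^sup>+\<omega>. ?\<tau> \<omega> \<partial>?R) = ennreal u"
    by (simp add: P0.expected_passage_time_started_from U)
  have \<tau>_finite: "AE \<omega> in ?R. ?\<tau> \<omega> \<noteq> \<top>"
    using nn_integral_PInf_AE[of ?\<tau> ?R] \<tau>_int by simp
  have T_meas: "T \<in> borel_measurable path_space"
    by (rule measurable_stopping_time[OF T]) (auto simp: natural.sets_F_mono)
  have A_meas: "A \<in> sets path_space"
    using natural.sets_pre_sigmaD[OF T A, of \<infinity>] by simp
  note [measurable] = T_meas A_meas
  define v where "v = enn2real (\<integral>\<^sup>+\<omega>. indicator A \<omega> * (?\<tau> \<omega> - T \<omega>) \<partial>?R)"
  have "(\<integral>\<^sup>+\<omega>. indicator A \<omega> * (?\<tau> \<omega> - T \<omega>) \<partial>?R) \<le> (\<integral>\<^sup>+\<omega>. ?\<tau> \<omega> \<partial>?R)"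
    by (intro nn_integral_mono) (auto simp: indicator_def diff_le_self_ennreal)
  then have V: "(\<integral>\<^sup>+\<omega>. indicator A \<omega> * (?\<tau> \<omega> - T \<omega>) \<partial>?R) = ennreal v"
    unfolding v_def \<tau>_int by (metis ennreal_enn2real ennreal_less_top order_le_less_trans)
  have v: "0 \<le> v" by (simp add: v_def)

  have "emeasure Pdown {\<omega> \<in> A. T \<omega> < lifetime \<omega>} = ennreal v / ennreal u"
    unfolding U[symmetric] V[symmetric]
    by (rule stopping_time_identity[OF Q_prob P0.sets_started_from first_passage_measurable _ _ _ T A])
       (use \<tau>_int a_x in \<open>auto simp: P0.h_transform_fixed_time[OF Q]\<close>)
  then have target: "measure Pdown {\<omega> \<in> A. T \<omega> < lifetime \<omega>} = v / u"
    using u v by (simp add: measure_def divide_ennreal)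

  \<comment> \<open>The conditioned side: numerator and denominator of the conditional probability as events for the
    pair of path and exponential time.\<close>
  define B where "B = {z \<in> space (path_space \<Otimes>\<^sub>M borel). fst z \<in> A \<and> T (fst z) < ennreal (snd z)
    \<and> ennreal (snd z) < ?\<tau> (fst z)}"
  define C where "C = {z \<in> space (path_space \<Otimes>\<^sub>M borel). ennreal (snd z) < ?\<tau> (fst z)}"
  have B: "B \<in> sets (path_space \<Otimes>\<^sub>M borel)" and C: "C \<in> sets (path_space \<Otimes>\<^sub>M borel)"
    unfolding B_def C_def by measurable
  have integral_B: "(\<integral>\<^sup>+\<omega>. \<integral>\<^sup>+t. indicator {0..} t * indicator B (\<omega>, t) \<partial>lborel \<partial>?R)
      = (\<integral>\<^sup>+\<omega>. indicator A \<omega> * (?\<tau> \<omega> - T \<omega>) \<partial>?R)"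
    using \<tau>_finite AE_space[of ?R]
  proof (intro nn_integral_cong_AE, eventually_elim)
    case (elim \<omega>)
    then have "\<omega> \<in> space path_space"
      using sets_eq_imp_space_eq[OF P0.sets_started_from] by simp
    then have "(\<integral>\<^sup>+t. indicator {0..} t * indicator B (\<omega>, t) \<partial>lborel)
        = (\<integral>\<^sup>+t. indicator A \<omega> * (indicator {0..} t *
            indicator {t. T \<omega> < ennreal t \<and> ennreal t < ?\<tau> \<omega>} t) \<partial>lborel)"
      by (intro nn_integral_cong) (auto simp: B_def indicator_def space_pair_measure)
    also have "\<dots> = indicator A \<omega> * (?\<tau> \<omega> - T \<omega>)"
      by (subst nn_integral_cmult) (auto simp: nn_integral_open_segment elim)
    finally show ?case .
  qed
  have limB: "((\<lambda>q. measure M {w \<in> space M. (X w, e q w) \<in> B} / q) \<longlongrightarrow> v) (at_right 0)"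
    by (rule exponential_clock_limit[OF M X e indep B _ v]) (simp_all only: law integral_B V)

  have integral_C: "(\<integral>\<^sup>+\<omega>. \<integral>\<^sup>+t. indicator {0..} t * indicator C (\<omega>, t) \<partial>lborel \<partial>?R) = (\<integral>\<^sup>+\<omega>. ?\<tau> \<omega> \<partial>?R)"
  proof (intro nn_integral_cong)
    fix \<omega> assume "\<omega> \<in> space ?R"
    then have "\<omega> \<in> space path_space"
      using sets_eq_imp_space_eq[OF P0.sets_started_from] by simp
    then have "(\<integral>\<^sup>+t. indicator {0..} t * indicator C (\<omega>, t) \<partial>lborel)
        = (\<integral>\<^sup>+t. indicator {t. 0 \<le> t \<and> ennreal t < ?\<tau> \<omega>} t \<partial>lborel)"
      by (intro nn_integral_cong) (auto simp: C_def indicator_def space_pair_measure)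
    then show "(\<integral>\<^sup>+t. indicator {0..} t * indicator C (\<omega>, t) \<partial>lborel) = ?\<tau> \<omega>"
      by (simp only: nn_integral_initial_segment)
  qed
  have limC: "((\<lambda>q. measure M {w \<in> space M. (X w, e q w) \<in> C} / q) \<longlongrightarrow> u) (at_right 0)"
    by (rule exponential_clock_limit[OF M X e indep C _ less_imp_le[OF u]]) (simp_all only: law integral_C \<tau>_int)

  have ratio: "\<P>(w in M. X w \<in> A \<and> T (X w) < ennreal (e q w) \<bar> ennreal (e q w) < ?\<tau> (X w))
      = (measure M {w \<in> space M. (X w, e q w) \<in> B} / q) / (measure M {w \<in> space M. (X w, e q w) \<in> C} / q)"
    if "0 < q" for q
  proof -
    have "{w \<in> space M. (X w, e q w) \<in> B} =
        {w \<in> space M. (X w \<in> A \<and> T (X w) < ennreal (e q w)) \<and> ennreal (e q w) < ?\<tau> (X w)}"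
      using measurable_space[OF X] by (auto simp: B_def space_pair_measure)
    moreover have "{w \<in> space M. (X w, e q w) \<in> C} = {w \<in> space M. ennreal (e q w) < ?\<tau> (X w)}"
      using measurable_space[OF X] by (auto simp: C_def space_pair_measure)
    ultimately show ?thesis
      using that by (simp add: cond_prob_def)
  qed
  have "((\<lambda>q. (measure M {w \<in> space M. (X w, e q w) \<in> B} / q) / (measure M {w \<in> space M. (X w, e q w) \<in> C} / q))
      \<longlongrightarrow> v / u) (at_right 0)"
    using u by (intro tendsto_divide limB limC) simp
  then show ?thesis
    unfolding target
  proof (rule Lim_transform_eventually)
    show "\<forall>\<^sub>F q in at_right 0.
        (measure M {w \<in> space M. (X w, e q w) \<in> B} / q) / (measure M {w \<in> space M. (X w, e q w) \<in> C} / q)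
        = \<P>(w in M. X w \<in> A \<and> T (X w) < ennreal (e q w) \<bar> ennreal (e q w) < ?\<tau> (X w))"
      using eventually_at_right_less[of 0] by eventually_elim (simp only: ratio)
  qed
qed

end
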